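(* Let $K$ be an infinite stable field with the property that for every (small) subset $B\subseteq K$ and all $x,y\in K$ that are non-generic over $B$, both $x+y$ and $x\cdot y$ are non-generic over $B$. Let $\mathbb{F}_p$ denote the prime subfield of $K$. Let $A\subseteq K$ be a (small) subset and $g,h\in K$. Suppose $g$ is generic over $A$ and $g$ is separably algebraic (in the field-theoretic sense) over the field $\mathbb{F}_p(A,h)$. Then $h$ is generic over $A$.
   Context: A stable field is a field $K$ considered as a first-order structure, endowed with its field operations and possibly additional relations, such that $\mathrm{Th}(K)$ is stable. By convention $K$ is a monster model (very saturated model) of its theory, and sets of parameters are small, i.e. of cardinality less than the degree of saturation. Generics: a definable subset $X$ of a stable group $G$ is generic if finitely many translates of $X$ cover $G$; a complete type over a set $A$ is generic if every formula in it defines a generic set; an element $g$ is generic over $A$ if $\mathrm{tp}(g/A)$ is generic, and non-generic over $A$ otherwise. An infinite stable field has a unique generic type (over each set of parameters), which is the generic type both of the additive and of the multiplicative group. Here $p$ is the characteristic of $K$ and $\mathbb{F}_p$ denotes the prime subfield of $K$ (so it is $\mathbb{Q}$ when the characteristic is $0$). $\mathbb{F}_p(A,h)$ is the subfield of $K$ generated by $A\cup\{h\}$. An element is separably algebraic over a subfield if it is a root of a separable polynomial over that subfield. *)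

theory Defs
  imports "HOL-Computational_Algebra.Polynomial"
begin

section \<open>Expansions of a field as first-order structures\<close>

text \<open>
  The universe is a whole type \<open>'a::field\<close>. The language consists of the ring operations
  and of relation symbols of type \<open>'r\<close>; inversion, being definable from multiplication, needs
  no symbol. A symbol \<open>r\<close> of arity \<open>n\<close> is interpreted by a set of lists of length \<open>n\<close>. Arities
  are not recorded: an atom whose argument list has the wrong length is simply false, so it adds
  nothing to what is definable. (A set containing lists of several lengths amounts to several
  relation symbols.)

  The constructor \<open>Cst\<close> provides names for elements of the universe, so that formulas with
  parameters in \<open>A\<close> are those with \<open>params \<phi> \<subseteq> A\<close> and formulas of the language proper are
  those with \<open>params \<phi> = {}\<close>.
\<close>

type_synonym ('r, 'a) struct = "'r \<Rightarrow> 'a list set"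

datatype (tm_params: 'a) tm =
    Var nat
  | Cst 'a
  | Zero
  | One
  | Add "'a tm" "'a tm"
  | Neg "'a tm"
  | Mul "'a tm" "'a tm"

datatype (params: 'a, rels: 'r) fm =
    FEq "'a tm" "'a tm"
  | FRel 'r "'a tm list"
  | FNot "('a, 'r) fm"
  | FAnd "('a, 'r) fm" "('a, 'r) fm"
  | FEx nat "('a, 'r) fm"

primrec tm_vars :: "'a tm \<Rightarrow> nat set" where
  "tm_vars (Var n) = {n}"
| "tm_vars (Cst a) = {}"
| "tm_vars Zero = {}"
| "tm_vars One = {}"
| "tm_vars (Add s t) = tm_vars s \<union> tm_vars t"
| "tm_vars (Neg t) = tm_vars t"
| "tm_vars (Mul s t) = tm_vars s \<union> tm_vars t"

primrec fv :: "('a, 'r) fm \<Rightarrow> nat set" where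
  "fv (FEq s t) = tm_vars s \<union> tm_vars t"
| "fv (FRel r ts) = (\<Union>t\<in>set ts. tm_vars t)"
| "fv (FNot \<phi>) = fv \<phi>"
| "fv (FAnd \<phi> \<psi>) = fv \<phi> \<union> fv \<psi>"
| "fv (FEx n \<phi>) = fv \<phi> - {n}"

primrec tm_val :: "(nat \<Rightarrow> 'a) \<Rightarrow> 'a::field tm \<Rightarrow> 'a" where
  "tm_val e (Var n) = e n"
| "tm_val e (Cst a) = a"
| "tm_val e Zero = 0"
| "tm_val e One = 1"
| "tm_val e (Add s t) = tm_val e s + tm_val e t"
| "tm_val e (Neg t) = - tm_val e t"
| "tm_val e (Mul s t) = tm_val e s * tm_val e t"

primrec sat :: "('r, 'a::field) struct \<Rightarrow> (nat \<Rightarrow> 'a) \<Rightarrow> ('a, 'r) fm \<Rightarrow> bool" where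
  "sat M e (FEq s t) \<longleftrightarrow> tm_val e s = tm_val e t"
| "sat M e (FRel r ts) \<longleftrightarrow> map (tm_val e) ts \<in> M r"
| "sat M e (FNot \<phi>) \<longleftrightarrow> \<not> sat M e \<phi>"
| "sat M e (FAnd \<phi> \<psi>) \<longleftrightarrow> sat M e \<phi> \<and> sat M e \<psi>"
| "sat M e (FEx n \<phi>) \<longleftrightarrow> (\<exists>a. sat M (e(n := a)) \<phi>)"

text \<open>Formulas over \<open>A\<close> in the single variable \<open>0\<close>, and the subsets of the universe they define.\<close>

definition formulas_over :: "'a set \<Rightarrow> ('a, 'r) fm set" where
  "formulas_over A = {\<phi>. fv \<phi> \<subseteq> {0} \<and> params \<phi> \<subseteq> A}"

definition defset :: "('r, 'a::field) struct \<Rightarrow> ('a, 'r) fm \<Rightarrow> 'a set" where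
  "defset M \<phi> = {x. sat M (\<lambda>_. x) \<phi>}"

definition tp :: "('r, 'a::field) struct \<Rightarrow> 'a set \<Rightarrow> 'a \<Rightarrow> ('a, 'r) fm set" where
  "tp M A g = {\<phi> \<in> formulas_over A. g \<in> defset M \<phi>}"

section \<open>Stability and saturation\<close>

text \<open>
  \<open>\<phi>(x; y)\<close> has the order property, where \<open>x\<close> stands for the variables below \<open>k\<close> and
  \<open>y\<close> for the remaining ones. Only the finitely many free variables of \<open>\<phi>\<close> matter, so \<open>a i\<close>
  and \<open>b j\<close> stand for finite tuples. Asking for arbitrarily long finite orders makes this a
  property of the complete theory of the structure; by compactness it holds iff some model of
  that theory contains an infinite such order.
\<close>

definition order_property :: "('r, 'a::field) struct \<Rightarrow> ('a, 'r) fm \<Rightarrow> nat \<Rightarrow> bool" where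
  "order_property M \<phi> k \<longleftrightarrow>
     (\<forall>n. \<exists>a b :: nat \<Rightarrow> nat \<Rightarrow> 'a. \<forall>i<n. \<forall>j<n.
        sat M (\<lambda>v. if v < k then a i v else b j v) \<phi> \<longleftrightarrow> i < j)"

definition stable_struct :: "('r, 'a::field) struct \<Rightarrow> bool" where
  "stable_struct M \<longleftrightarrow> (\<forall>\<phi> k. params \<phi> = {} \<longrightarrow> \<not> order_property M \<phi> k)"

text \<open>The cardinal \<open>\<kappa>\<close> is the degree of saturation.\<close>

context
  includes cardinal_syntax
begin

definition small :: "'c rel \<Rightarrow> 'a set \<Rightarrow> bool" where
  "small \<kappa> A \<longleftrightarrow> |A| <o \<kappa>"

definition saturated :: "'c rel \<Rightarrow> ('r, 'a::field) struct \<Rightarrow> bool" where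
  "saturated \<kappa> M \<longleftrightarrow>
     (\<forall>B p. small \<kappa> B \<and> p \<subseteq> formulas_over B \<and>
        (\<forall>q. finite q \<and> q \<subseteq> p \<longrightarrow> (\<exists>x. \<forall>\<phi>\<in>q. x \<in> defset M \<phi>)) \<longrightarrow>
        (\<exists>x. \<forall>\<phi>\<in>p. x \<in> defset M \<phi>))"

text \<open>``Very saturated'': \<open>\<kappa>\<close>-saturated for a cardinal \<open>\<kappa>\<close> above the cardinality of the language.\<close>

definition monster_model :: "'c rel \<Rightarrow> ('r, 'a::field) struct \<Rightarrow> bool" where
  "monster_model \<kappa> M \<longleftrightarrow>
     Card_order \<kappa> \<and> natLeq <o \<kappa> \<and> |UNIV :: 'r set| <o \<kappa> \<and> saturated \<kappa> M"

end

section \<open>Generics\<close>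

text \<open>
  Genericity is taken with respect to the additive group. In an infinite stable field the
  generic type of the additive group is also that of the multiplicative group.
\<close>

definition generic_set :: "'a::ab_group_add set \<Rightarrow> bool" where
  "generic_set X \<longleftrightarrow> (\<exists>T. finite T \<and> (\<Union>t\<in>T. (+) t ` X) = UNIV)"

definition generic_type :: "('r, 'a::field) struct \<Rightarrow> ('a, 'r) fm set \<Rightarrow> bool" where
  "generic_type M p \<longleftrightarrow> (\<forall>\<phi>\<in>p. generic_set (defset M \<phi>))"

definition generic_over :: "('r, 'a::field) struct \<Rightarrow> 'a set \<Rightarrow> 'a \<Rightarrow> bool" where
  "generic_over M A g \<longleftrightarrow> generic_type M (tp M A g)"

section \<open>Subfields and separable algebraicity\<close>

text \<open>The subfield generated by \<open>S\<close> is \<open>is_subfield hull S\<close>.\<close>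

definition is_subfield :: "'a::field set \<Rightarrow> bool" where
  "is_subfield F \<longleftrightarrow>
     0 \<in> F \<and> 1 \<in> F \<and> (\<forall>x\<in>F. \<forall>y\<in>F. x + y \<in> F \<and> x * y \<in> F) \<and>
     (\<forall>x\<in>F. - x \<in> F \<and> inverse x \<in> F)"

definition separable_poly :: "'a::field poly \<Rightarrow> bool" where
  "separable_poly q \<longleftrightarrow> coprime q (pderiv q)"

definition separably_algebraic :: "'a::field set \<Rightarrow> 'a \<Rightarrow> bool" where
  "separably_algebraic F g \<longleftrightarrow>
     (\<exists>q. (\<forall>i. coeff q i \<in> F) \<and> separable_poly q \<and> poly q g = 0)"

end

theory Submission
  imports Defs "HOL-Library.FuncSet"
begin

text \<open>
  Stability forbids long ladders \<open>R a\<^sub>i b\<^sub>j \<longleftrightarrow> i < j\<close>. Applied to \<open>x + y \<in> X\<close> this makes the nongeneric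
  definable sets an ideal. Applied to \<open>a x + b \<in> X\<close> it makes the affine preimages of \<open>X\<close> finite in
  number modulo that ideal, and since an infinite field has no proper ideal of finite index,
  translations fix \<open>X\<close> modulo nongeneric sets. Hence the generic type over each set is unique, and a
  further ladder gives the symmetry of independence for generics.

  By hypothesis the nongenerics over \<open>B\<close> form a subfield \<open>N(B)\<close>. Suppose a generic \<open>g\<close> is a simple root of a
  polynomial over \<open>N(B)\<close>, and take one, \<open>q\<close>, of least degree among all \<open>B\<close>. Translating \<open>g\<close> by an
  independent generic \<open>w\<close> and comparing minimal polynomials shows that \<open>q(w)\<close> is nongeneric. The
  polynomials with nongeneric values at generics independent of some small set form a vector space
  closed under affine substitutions, so if one of them has a nonzero derivative then the identity
  polynomial is among them, which is absurd.
\<close>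

section \<open>Definable predicates\<close>

text \<open>Stability concerns formulas without parameters, so parameters must be traded for
  variables. As \<open>f\<close> is partial, either all of them or a single one can be
  traded.\<close>

primrec abs_tm :: "('a \<Rightarrow> nat option) \<Rightarrow> 'a tm \<Rightarrow> 'a tm" where
  "abs_tm f (Var n) = Var n"
| "abs_tm f (Cst a) = (case f a of None \<Rightarrow> Cst a | Some n \<Rightarrow> Var n)"
| "abs_tm f Zero = Zero"
| "abs_tm f One = One"
| "abs_tm f (Add s t) = Add (abs_tm f s) (abs_tm f t)"
| "abs_tm f (Neg t) = Neg (abs_tm f t)"
| "abs_tm f (Mul s t) = Mul (abs_tm f s) (abs_tm f t)"

primrec abs_fm :: "('a \<Rightarrow> nat option) \<Rightarrow> ('a, 'r) fm \<Rightarrow> ('a, 'r) fm" where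
  "abs_fm f (FEq s t) = FEq (abs_tm f s) (abs_tm f t)"
| "abs_fm f (FRel r ts) = FRel r (map (abs_tm f) ts)"
| "abs_fm f (FNot \<phi>) = FNot (abs_fm f \<phi>)"
| "abs_fm f (FAnd \<phi> \<psi>) = FAnd (abs_fm f \<phi>) (abs_fm f \<psi>)"
| "abs_fm f (FEx n \<phi>) = FEx n (abs_fm f \<phi>)"

text \<open>Bound variables count as well, so that an index outside this set is never captured by a
  quantifier.\<close>

primrec avars :: "('a, 'r) fm \<Rightarrow> nat set" where
  "avars (FEq s t) = tm_vars s \<union> tm_vars t"
| "avars (FRel r ts) = (\<Union>t\<in>set ts. tm_vars t)"
| "avars (FNot \<phi>) = avars \<phi>"
| "avars (FAnd \<phi> \<psi>) = avars \<phi> \<union> avars \<psi>"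
| "avars (FEx n \<phi>) = insert n (avars \<phi>)"

lemma finite_tm_vars: "finite (tm_vars t)"
  by (induction t) auto

lemma finite_avars: "finite (avars \<phi>)"
  by (induction \<phi>) (auto simp: finite_tm_vars)

lemma fv_subset_avars: "fv \<phi> \<subseteq> avars \<phi>"
  by (induction \<phi>) auto

lemma finite_fv: "finite (fv \<phi>)"
  using finite_avars fv_subset_avars finite_subset by blast

lemma finite_tm_params: "finite (tm_params t)"
  by (induction t) auto

lemma finite_params: "finite (params \<phi>)"
  by (induction \<phi>) (auto simp: finite_tm_params)

lemma tm_val_abs:
  assumes "\<And>v. v \<in> tm_vars t \<Longrightarrow> e' v = e v"
    and "\<And>a n. a \<in> tm_params t \<Longrightarrow> f a = Some n \<Longrightarrow> e' n = a"
  shows "tm_val e' (abs_tm f t) = tm_val e t"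
  using assms by (induction t) (auto split: option.splits)

text \<open>The indices given by \<open>f\<close> avoid every quantified variable, so the value that
  \<open>e'\<close> stores for a parameter survives the updates made by quantifiers.\<close>

lemma sat_abs:
  assumes "\<And>v. v \<in> avars \<phi> \<Longrightarrow> e' v = e v"
    and "\<And>a n. a \<in> params \<phi> \<Longrightarrow> f a = Some n \<Longrightarrow> e' n = a \<and> n \<notin> avars \<phi>"
  shows "sat M e' (abs_fm f \<phi>) = sat M e \<phi>"
  using assms
proof (induction \<phi> arbitrary: e e')
  case (FEq s t)
  have "tm_val e' (abs_tm f s) = tm_val e s" "tm_val e' (abs_tm f t) = tm_val e t"
    using FEq by (auto intro!: tm_val_abs)
  then show ?case by simp
next
  case (FRel r ts)
  have "tm_val e' (abs_tm f t) = tm_val e t" if "t \<in> set ts" for t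
  proof (rule tm_val_abs)
    show "e' v = e v" if "v \<in> tm_vars t" for v
      using FRel.prems(1) \<open>t \<in> set ts\<close> that by auto
    show "e' n = a" if "a \<in> tm_params t" "f a = Some n" for a n
      using FRel.prems(2)[of a n] \<open>t \<in> set ts\<close> that by auto
  qed
  then have "map (tm_val e') (map (abs_tm f) ts) = map (tm_val e) ts" by simp
  then show ?case by (simp del: map_map)
next
  case (FEx n \<phi>)
  have "sat M (e'(n := a)) (abs_fm f \<phi>) = sat M (e(n := a)) \<phi>" for a
    by (rule FEx.IH) (use FEx.prems in auto)
  then show ?case by simp
next
  case (FAnd \<phi> \<psi>)
  have "sat M e' (abs_fm f \<phi>) = sat M e \<phi>" "sat M e' (abs_fm f \<psi>) = sat M e \<psi>"
    by (rule FAnd.IH; use FAnd.prems in auto)+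
  then show ?case by simp
qed auto

lemma tm_params_abs: "tm_params (abs_tm f t) \<subseteq> {a \<in> tm_params t. f a = None}"
  by (induction t) (auto split: option.splits)

lemma params_abs: "params (abs_fm f \<phi>) \<subseteq> {a \<in> params \<phi>. f a = None}"
proof (induction \<phi>)
  case (FEq s t)
  then show ?case using tm_params_abs[of f s] tm_params_abs[of f t] by auto
next
  case (FRel r ts)
  then show ?case using tm_params_abs[of f] by fastforce
qed auto

lemma tm_val_cong: "(\<And>v. v \<in> tm_vars t \<Longrightarrow> e v = e' v) \<Longrightarrow> tm_val e t = tm_val e' t"
  by (induction t) auto

lemma sat_cong: "(\<And>v. v \<in> fv \<phi> \<Longrightarrow> e v = e' v) \<Longrightarrow> sat M e \<phi> = sat M e' \<phi>"
proof (induction \<phi> arbitrary: e e')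
  case (FEq s t)
  have "tm_val e s = tm_val e' s" "tm_val e t = tm_val e' t"
    using FEq by (auto intro!: tm_val_cong)
  then show ?case by simp
next
  case (FRel r ts)
  have "map (tm_val e) ts = map (tm_val e') ts"
    using FRel by (auto intro!: tm_val_cong)
  then show ?case by (simp del: map_eq_conv)
next
  case (FEx n \<phi>)
  have "sat M (e(n := a)) \<phi> = sat M (e'(n := a)) \<phi>" for a
    by (rule FEx.IH) (use FEx.prems in auto)
  then show ?case by simp
next
  case (FAnd \<phi> \<psi>)
  have "sat M e \<phi> = sat M e' \<phi>" "sat M e \<psi> = sat M e' \<psi>"
    by (rule FAnd.IH; use FAnd.prems in auto)+
  then show ?case by simp
next
  case (FNot \<phi>)
  have "sat M e \<phi> = sat M e' \<phi>" by (rule FNot.IH) (use FNot.prems in auto)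
  then show ?case by simp
qed

text \<open>Speaking of predicates on valuations hides the formula, so closure properties can be
  stated without syntax.\<close>

definition dfn :: "('r, 'a::field) struct \<Rightarrow> 'a set \<Rightarrow> ((nat \<Rightarrow> 'a) \<Rightarrow> bool) \<Rightarrow> bool" where
  "dfn M B P \<longleftrightarrow> (\<exists>\<phi>. params \<phi> \<subseteq> B \<and> (\<forall>e. sat M e \<phi> = P e))"

lemma dfn_mono: "dfn M B P \<Longrightarrow> B \<subseteq> C \<Longrightarrow> dfn M C P"
  unfolding dfn_def by blast

lemma dfn_cong: "dfn M B P \<Longrightarrow> (\<And>e. P e = Q e) \<Longrightarrow> dfn M B Q"
  unfolding dfn_def by simp

lemma dfn_not: "dfn M B P \<Longrightarrow> dfn M B (\<lambda>e. \<not> P e)"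
  unfolding dfn_def by (elim exE, rule_tac x = "FNot \<phi>" in exI) auto

lemma dfn_conj: assumes "dfn M B P" "dfn M B Q" shows "dfn M B (\<lambda>e. P e \<and> Q e)"
proof -
  from assms obtain \<phi> \<psi> where "params \<phi> \<subseteq> B" "\<forall>e. sat M e \<phi> = P e"
    "params \<psi> \<subseteq> B" "\<forall>e. sat M e \<psi> = Q e" unfolding dfn_def by auto
  then show ?thesis unfolding dfn_def by (intro exI[of _ "FAnd \<phi> \<psi>"]) auto
qed

lemma dfn_disj: "dfn M B P \<Longrightarrow> dfn M B Q \<Longrightarrow> dfn M B (\<lambda>e. P e \<or> Q e)"
  using dfn_not[OF dfn_conj[OF dfn_not dfn_not]] by simp

lemma dfn_ex: assumes "dfn M B P" shows "dfn M B (\<lambda>e. \<exists>a. P (e(n := a)))"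
proof -
  from assms obtain \<phi> where "params \<phi> \<subseteq> B" "\<forall>e. sat M e \<phi> = P e"
    unfolding dfn_def by auto
  then show ?thesis unfolding dfn_def by (intro exI[of _ "FEx n \<phi>"]) auto
qed

lemma dfn_all: "dfn M B P \<Longrightarrow> dfn M B (\<lambda>e. \<forall>a. P (e(n := a)))"
  using dfn_not[OF dfn_ex[OF dfn_not]] by simp

lemma dfn_eq:
  assumes "tm_params s \<subseteq> B" "tm_params t \<subseteq> B"
  shows "dfn M B (\<lambda>e. tm_val e s = tm_val e t)"
  unfolding dfn_def by (rule exI[of _ "FEq s t"]) (use assms in auto)

lemma dfn_finite_support:
  assumes "dfn M B P"
  shows "\<exists>N. \<forall>e e'. (\<forall>v<N. e v = e' v) \<longrightarrow> P e = P e'"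
proof -
  from assms obtain \<phi> where \<phi>: "\<forall>e. sat M e \<phi> = P e" unfolding dfn_def by auto
  obtain N where "\<forall>v\<in>fv \<phi>. v < N"
    using finite_nat_set_iff_bounded finite_fv by blast
  then have "P e = P e'" if "\<forall>v<N. e v = e' v" for e e'
    using sat_cong[of \<phi> e e' M] \<phi> that by auto
  then show ?thesis by blast
qed

text \<open>Substitution is expressed by a quantifier: some value of the variable equals the term
  and satisfies the predicate. This requires a variable absent from the term, so \<open>n\<close> is
  first replaced by a fresh \<open>m\<close>, and then \<open>m\<close> by \<open>t\<close>.\<close>

lemma dfn_subst:
  assumes P: "dfn M B P" and t: "tm_params t \<subseteq> B"
  shows "dfn M B (\<lambda>e. P (e(n := tm_val e t)))"
proof -
  have *: "dfn M B (\<lambda>e. Q (e(m := tm_val e s)))"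
    if Q: "dfn M B Q" and s: "tm_params s \<subseteq> B" and m: "m \<notin> tm_vars s" for Q m s
  proof -
    have s': "tm_val (e(m := a)) s = tm_val e s" for e a
      by (rule tm_val_cong) (use m in auto)
    have "dfn M B (\<lambda>e. \<exists>a. tm_val (e(m := a)) (Var m) = tm_val (e(m := a)) s \<and> Q (e(m := a)))"
      using dfn_ex[OF dfn_conj[OF dfn_eq[of "Var m" B s] Q], of m] s by simp
    then show ?thesis by (rule dfn_cong) (simp add: s')
  qed
  obtain N where N: "\<forall>e e'. (\<forall>v<N. e v = e' v) \<longrightarrow> P e = P e'"
    using dfn_finite_support[OF P] ..
  obtain K where K: "\<forall>v\<in>tm_vars t. v < K"
    using finite_nat_set_iff_bounded finite_tm_vars by blast
  define m where "m = Suc (N + K + n)"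
  have m: "m \<ge> N" "m \<notin> tm_vars t" "m > n"
    using K by (auto simp: m_def)
  have "dfn M B (\<lambda>e. P ((e(m := tm_val e t))(n := (e(m := tm_val e t)) m)))"
    using *[OF *[OF P, of "Var m" n] t, of m] m by simp
  then show ?thesis
    by (rule dfn_cong, intro N[rule_format]) (use m in auto)
qed

lemma dfn_rename: "dfn M B P \<Longrightarrow> dfn M B (\<lambda>e. P (e(n := e m)))"
  using dfn_subst[of M B P "Var m" n] by simp

lemma dfn_inst: "dfn M B P \<Longrightarrow> b \<in> B \<Longrightarrow> dfn M B (\<lambda>e. P (e(n := b)))"
  using dfn_subst[of M B P "Cst b" n] by simp

text \<open>The parameter \<open>b\<close> becomes a variable \<open>m\<close> above all variables
  of the formula; the bound \<open>k\<close> keeps \<open>m\<close> away from variables reserved for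
  other purposes.\<close>

lemma dfn_insertE:
  assumes "dfn M (insert b B) P"
  obtains Q m where "dfn M B Q" "k \<le> m" "\<And>e. P e = Q (e(m := b))"
proof -
  from assms obtain \<phi> where \<phi>: "params \<phi> \<subseteq> insert b B" "\<forall>e. sat M e \<phi> = P e"
    unfolding dfn_def by auto
  obtain N where N: "\<forall>v\<in>avars \<phi>. v < N"
    using finite_nat_set_iff_bounded finite_avars by blast
  define m where "m = max N k"
  let ?f = "\<lambda>a. if a = b then Some m else None"
  have "dfn M B (\<lambda>e. sat M e (abs_fm ?f \<phi>))"
    unfolding dfn_def using params_abs[of ?f \<phi>] \<phi>(1) by (intro exI[of _ "abs_fm ?f \<phi>"]) fastforce
  moreover have "k \<le> m" by (simp add: m_def)
  moreover have "P e = sat M (e(m := b)) (abs_fm ?f \<phi>)" for e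
  proof -
    have "sat M (e(m := b)) (abs_fm ?f \<phi>) = sat M e \<phi>"
      by (rule sat_abs) (use N in \<open>auto simp: m_def split: if_splits\<close>)
    then show ?thesis using \<phi>(2) by simp
  qed
  ultimately show ?thesis by (rule that)
qed

section \<open>Ladders\<close>

definition ladder :: "('x \<Rightarrow> 'y \<Rightarrow> bool) \<Rightarrow> nat \<Rightarrow> bool" where
  "ladder R n \<longleftrightarrow> (\<exists>a b. \<forall>i<n. \<forall>j<n. R (a i) (b j) \<longleftrightarrow> i < j)"

text \<open>The parameters become entries of the right-hand tuple that are the same for all
  \<open>j\<close>. The left-hand tuple is variable \<open>0\<close> alone.\<close>

lemma stable_no_ladder:
  fixes M :: "('r, 'a::field) struct"
  assumes "stable_struct M" and "dfn M B P"
  shows "\<exists>n. \<not> ladder (\<lambda>x y. P (case_nat x (f y))) n"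
proof -
  from assms(2) obtain \<phi> :: "('a, 'r) fm" where \<phi>: "\<forall>e. sat M e \<phi> = P e" unfolding dfn_def by auto
  obtain N0 where N0: "\<forall>v\<in>avars \<phi>. v < N0"
    using finite_nat_set_iff_bounded finite_avars by blast
  \<comment> \<open>The successor keeps \<open>N\<close> positive, so no parameter is stored in
    variable \<open>0\<close>.\<close>
  define N where "N = Suc N0"
  obtain idx :: "'a \<Rightarrow> nat" where idx: "inj_on idx (params \<phi>)"
    using finite_imp_inj_to_nat_seg[OF finite_params[of \<phi>]] that by (elim exE conjE)
  define c where "c = inv_into (params \<phi>) idx"
  let ?f = "\<lambda>a. Some (N + idx a)"
  have "params (abs_fm ?f \<phi>) = {}" using params_abs[of ?f \<phi>] by auto
  then have "\<not> order_property M (abs_fm ?f \<phi>) 1"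
    using assms(1) unfolding stable_struct_def by blast
  then obtain n :: nat where n: "\<not> (\<exists>a b. \<forall>i<n. \<forall>j<n.
     sat M (\<lambda>v. if v < 1 then a i v else b j v) (abs_fm ?f \<phi>) = (i < j))"
    unfolding order_property_def by (subst (asm) not_all) (elim exE)
  have "\<not> ladder (\<lambda>x y. P (case_nat x (f y))) n"
    unfolding ladder_def
  proof (intro notI, elim exE)
    fix a b assume ab: "\<forall>i<n. \<forall>j<n. P (case_nat (a i) (f (b j))) = (i < j)"
    \<comment> \<open>At variable \<open>0\<close> the entry \<open>a 0\<close> is a dummy: that
      variable is read from the left-hand tuple.\<close>
    let ?b = "\<lambda>j v. if v < N then case_nat (a 0) (f (b j)) v else c (v - N)"
    obtain i j where ij: "i < n" "j < n"
      "sat M (\<lambda>v. if v < 1 then a i else ?b j v) (abs_fm ?f \<phi>) \<noteq> (i < j)"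
      using n[unfolded not_ex, THEN spec, THEN spec, of "\<lambda>i v. a i" ?b] by blast
    have "sat M (\<lambda>v. if v < 1 then a i else ?b j v) (abs_fm ?f \<phi>)
        = sat M (case_nat (a i) (f (b j))) \<phi>"
    proof (rule sat_abs)
      fix v assume "v \<in> avars \<phi>"
      then have "v < N" using N0 by (auto simp: N_def)
      then show "(if v < 1 then a i else ?b j v) = case_nat (a i) (f (b j)) v"
        by (auto split: nat.splits)
    next
      fix p m assume "p \<in> params \<phi>" "Some (N + idx p) = Some m"
      then show "(if m < 1 then a i else ?b j m) = p \<and> m \<notin> avars \<phi>"
        using N0 idx by (auto simp: N_def c_def)
    qed
    then show False using ij ab \<phi> by simp
  qed
  then show ?thesis ..
qed

text \<open>The sequences grow alternately: a new right point related to all earlier left points,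
  then a new left point unrelated to all right points, the newest included.\<close>

lemma ladderI_alternate:
  assumes y: "\<And>S. finite S \<Longrightarrow> S \<subseteq> A \<Longrightarrow> \<exists>y\<in>C. \<forall>x\<in>S. R x y"
    and x: "\<And>T. finite T \<Longrightarrow> T \<subseteq> C \<Longrightarrow> \<exists>x\<in>A. \<forall>y\<in>T. \<not> R x y"
  shows "ladder R n"
proof -
  have "\<exists>a b. (\<forall>i<n. a i \<in> A \<and> b i \<in> C) \<and> (\<forall>i<n. \<forall>j<n. R (a i) (b j) \<longleftrightarrow> i < j)"
  proof (induction n)
    case (Suc n)
    then obtain a b where ab: "\<forall>i<n. a i \<in> A \<and> b i \<in> C" "\<forall>i<n. \<forall>j<n. R (a i) (b j) \<longleftrightarrow> i < j"
      by blast
    obtain v where v: "v \<in> C" "\<forall>x\<in>a ` {..<n}. R x v"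
      using y[of "a ` {..<n}"] ab(1) by auto
    obtain u where u: "u \<in> A" "\<forall>y\<in>insert v (b ` {..<n}). \<not> R u y"
      using x[of "insert v (b ` {..<n})"] ab(1) v(1) by auto
    show ?case
      using ab v u by (intro exI[of _ "a(n := u)"] exI[of _ "b(n := v)"]) (auto simp: less_Suc_eq)
  qed simp
  then show ?thesis unfolding ladder_def by blast
qed

text \<open>Shifting the left sequence by one turns \<open>i \<le> j\<close> into
  \<open>i < j\<close> at the cost of one rung.\<close>

lemma ladder_of_le:
  assumes "\<And>i j. i < Suc n \<Longrightarrow> j < Suc n \<Longrightarrow> R (a i) (b j) \<longleftrightarrow> i \<le> j"
  shows "ladder R n"
  unfolding ladder_def
  using assms by (intro exI[of _ "\<lambda>i. a (Suc i)"] exI[of _ b]) (auto simp: Suc_le_eq)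

lemma ladder_of_gr:
  assumes "\<And>i j. i < n \<Longrightarrow> j < n \<Longrightarrow> R (a i) (b j) \<longleftrightarrow> i > j"
  shows "ladder R n"
  unfolding ladder_def
  using assms by (intro exI[of _ "\<lambda>i. a (n - 1 - i)"] exI[of _ "\<lambda>i. b (n - 1 - i)"]) auto

lemma ladder_comp: "ladder (\<lambda>x y. R x (h y)) n \<Longrightarrow> ladder R n"
  unfolding ladder_def by (elim exE, rule_tac x = a in exI, rule_tac x = "h \<circ> b" in exI) auto

text \<open>By pigeonhole \<open>Suc n\<close> indices share a colour. Among these the relation is
  \<open>i \<le> j\<close> or \<open>i > j\<close>, depending on the colour.\<close>

lemma ladder_of_colouring:
  fixes x :: "nat \<Rightarrow> 'x" and y :: "nat \<Rightarrow> 'y"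
  assumes col: "\<And>i j. i < 2 * Suc n \<Longrightarrow> j < 2 * Suc n \<Longrightarrow>
      R (x i) (y j) \<longleftrightarrow> (if i \<le> j then \<epsilon> i else \<not> \<epsilon> j)"
  shows "ladder R n"
proof -
  let ?J = "\<lambda>c. {i. i < 2 * Suc n \<and> \<epsilon> i = c}"
  have fin: "finite (?J c)" for c by simp
  have "{..<2 * Suc n} = ?J True \<union> ?J False" by auto
  then have "2 * Suc n \<le> card (?J True) + card (?J False)"
    by (metis card_Un_le card_lessThan)
  moreover have "Suc n \<le> k \<or> Suc n \<le> l" if "2 * Suc n \<le> k + l" for k l :: nat
    using that by arith
  ultimately have "Suc n \<le> card (?J True) \<or> Suc n \<le> card (?J False)" by blast
  then obtain c where c: "Suc n \<le> card (?J c)" using that by blast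
  obtain h where h: "bij_betw h {..<card (?J c)} (?J c)" "strict_mono_on {..<card (?J c)} h"
    by (rule ex_bij_betw_strict_mono_card[OF fin[of c]])
  have hJ: "h i \<in> ?J c" if "i < Suc n" for i
    using bij_betwE[OF h(1)] c that by simp
  have hle: "h i \<le> h j \<longleftrightarrow> i \<le> j" if "i < Suc n" "j < Suc n" for i j
    using strict_mono_on_less_eq[OF h(2), of i j] that c by simp
  have R: "R (x (h i)) (y (h j)) \<longleftrightarrow> (if i \<le> j then c else \<not> c)" if "i < Suc n" "j < Suc n" for i j
    using col[of "h i" "h j"] hJ[OF that(1)] hJ[OF that(2)] hle[OF that] by auto
  show ?thesis
  proof (cases c)
    case True
    show ?thesis by (rule ladder_of_le[of n R "x \<circ> h" "y \<circ> h"]) (use R True in auto)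
  next
    case False
    show ?thesis by (rule ladder_of_gr[of n R "x \<circ> h" "y \<circ> h"]) (use R False in auto)
  qed
qed

text \<open>Each new point \<open>u\<close> is given a colour \<open>c\<close> that, after shrinking \<open>Z\<close>, decides \<open>u \<in> S d\<close> for a
  family of \<open>d\<close> still splitting every positive subset of \<open>Z\<close>. Shrinking \<open>Z\<close> further to the side of the
  next \<open>S v\<close> of the opposite colour gives all later points the opposite colour there. Points of
  equal colour then form a ladder.\<close>

lemma ladderI_split:
  fixes S :: "'y \<Rightarrow> 'x set" and pos :: "'x set \<Rightarrow> bool"
  defines "split \<equiv> \<lambda>Z y. pos (Z \<inter> S y) \<and> pos (Z - S y)"
  assumes ne: "\<And>Z. pos Z \<Longrightarrow> Z \<noteq> {}" and "pos Zinit"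
    and mono: "\<And>Z Z' y. pos Z \<Longrightarrow> pos Z' \<Longrightarrow> Z' \<subseteq> Z \<Longrightarrow> y \<in> Y \<Longrightarrow> split Z' y \<Longrightarrow> split Z y"
    and every: "\<And>Z. pos Z \<Longrightarrow> \<exists>y\<in>Y. split Z y"
  shows "ladder (\<lambda>x y. x \<in> S y) n"
proof -
  define dense where "dense = (\<lambda>D Z. D \<subseteq> Y \<and> (\<forall>Z'. pos Z' \<and> Z' \<subseteq> Z \<longrightarrow> (\<exists>d\<in>D. split Z' d)))"
  have dense_mono: "dense D Z'" if "dense D Z" "Z' \<subseteq> Z" for D Z Z'
    using that unfolding dense_def by blast
  have colour: "\<exists>Z' D' c. pos Z' \<and> Z' \<subseteq> Z \<and> D' \<subseteq> D \<and> dense D' Z' \<and> (\<forall>d\<in>D'. (x \<in> S d) = c)"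
    if D: "dense D Z" and Z: "pos Z" for D Z x
  proof (cases "dense {d \<in> D. x \<notin> S d} Z")
    case True
    then show ?thesis using Z by (intro exI[of _ Z] exI[of _ "{d \<in> D. x \<notin> S d}"] exI[of _ False]) auto
  next
    \<comment> \<open>Some positive \<open>Z'\<close> is split by no \<open>d\<close> with
      \<open>x \<notin> S d\<close>. By monotonicity these do not split its positive subsets either,
      so there the sets containing \<open>x\<close> do all the splitting.\<close>
    case False
    moreover have "{d \<in> D. x \<notin> S d} \<subseteq> Y" using D unfolding dense_def by auto
    ultimately have "\<not> (\<forall>Z'. pos Z' \<and> Z' \<subseteq> Z \<longrightarrow> (\<exists>d\<in>{d \<in> D. x \<notin> S d}. split Z' d))"
      unfolding dense_def by (simp only: simp_thms)
    then obtain Z' where Z'_neg: "\<not> (pos Z' \<and> Z' \<subseteq> Z \<longrightarrow> (\<exists>d\<in>{d \<in> D. x \<notin> S d}. split Z' d))"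
      by (subst (asm) not_all) (elim exE)
    then have Z': "pos Z'" "Z' \<subseteq> Z" by (simp_all only: not_imp)
    have Z'_unsplit: "\<not> split Z' d" if "d \<in> D" "x \<notin> S d" for d using Z'_neg that by blast
    have "\<exists>d\<in>D. x \<in> S d \<and> split Z'' d" if "pos Z''" "Z'' \<subseteq> Z'" for Z''
    proof -
      have "Z'' \<subseteq> Z" using that Z' by simp
      then obtain d where d: "d \<in> D" "split Z'' d"
        using D \<open>pos Z''\<close> unfolding dense_def by blast
      have "d \<in> Y" using D d(1) unfolding dense_def by blast
      then have "split Z' d" using mono[OF Z'(1)] that d(2) by simp
      then show ?thesis using Z'_unsplit d by blast
    qed
    then have "dense {d \<in> D. x \<in> S d} Z'" using D unfolding dense_def by blast
    then show ?thesis using Z' by (intro exI[of _ Z'] exI[of _ "{d \<in> D. x \<in> S d}"] exI[of _ True]) auto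
  qed
  \<comment> \<open>Invariant: later sets come from \<open>D\<close>, on which each old point has
    its own colour; later points come from \<open>Z\<close>, and at each old set they show the
    opposite of its colour.\<close>
  have "\<exists>x \<epsilon> y Z D. pos Z \<and> dense D Z
      \<and> (\<forall>i<m. \<forall>j<m. (x i \<in> S (y j)) = (if i \<le> j then \<epsilon> i else \<not> \<epsilon> j))
      \<and> (\<forall>i<m. \<forall>d\<in>D. (x i \<in> S d) = \<epsilon> i) \<and> (\<forall>z\<in>Z. \<forall>j<m. (z \<in> S (y j)) = (\<not> \<epsilon> j))" for m :: nat
  proof (induction m)
    case 0
    have "dense Y Zinit" using every unfolding dense_def by blast
    then show ?case using \<open>pos Zinit\<close> by auto
  next
    case (Suc m)
    then obtain x \<epsilon> y Z D where st: "pos Z" "dense D Z"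
      "\<forall>i<m. \<forall>j<m. (x i \<in> S (y j)) = (if i \<le> j then \<epsilon> i else \<not> \<epsilon> j)"
      "\<forall>i<m. \<forall>d\<in>D. (x i \<in> S d) = \<epsilon> i" "\<forall>z\<in>Z. \<forall>j<m. (z \<in> S (y j)) = (\<not> \<epsilon> j)"
      by blast
    obtain u where u: "u \<in> Z" using ne[OF st(1)] by blast
    obtain Z' D' c where Z': "pos Z'" "Z' \<subseteq> Z" "D' \<subseteq> D" "dense D' Z'" "\<forall>d\<in>D'. (u \<in> S d) = c"
      using colour[OF st(2,1), of u] by blast
    obtain v where v: "v \<in> D'" "split Z' v" using Z' unfolding dense_def by blast
    define W where "W = (if c then Z' - S v else Z' \<inter> S v)"
    have W: "pos W" "W \<subseteq> Z'" "\<forall>z\<in>W. (z \<in> S v) = (\<not> c)"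
      using v unfolding W_def split_def by auto
    let ?x = "x(m := u)" and ?\<epsilon> = "\<epsilon>(m := c)" and ?y = "y(m := v)"
    have "dense D' W" using dense_mono[OF Z'(4) W(2)] .
    moreover have "\<forall>i<Suc m. \<forall>j<Suc m. (?x i \<in> S (?y j)) = (if i \<le> j then ?\<epsilon> i else \<not> ?\<epsilon> j)"
      using st(3-5) u v Z' by (auto simp: less_Suc_eq)
    moreover have "\<forall>i<Suc m. \<forall>d\<in>D'. (?x i \<in> S d) = ?\<epsilon> i"
      using st(4) Z' by (auto simp: less_Suc_eq)
    moreover have "\<forall>z\<in>W. \<forall>j<Suc m. (z \<in> S (?y j)) = (\<not> ?\<epsilon> j)"
      using st(5) Z' W by (auto simp: less_Suc_eq)
    ultimately show ?case using W(1) by blast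
  qed
  from this[of "2 * Suc n"] obtain x \<epsilon> y where
    "\<forall>i<2 * Suc n. \<forall>j<2 * Suc n. (x i \<in> S (y j)) = (if i \<le> j then \<epsilon> i else \<not> \<epsilon> j)" by blast
  then show ?thesis by (intro ladder_of_colouring[where x = x and y = y and \<epsilon> = \<epsilon>]) auto
qed

section \<open>Definable and generic sets\<close>

definition definable :: "('r, 'a::field) struct \<Rightarrow> 'a set \<Rightarrow> 'a set \<Rightarrow> bool" where
  "definable M B X \<longleftrightarrow> dfn M B (\<lambda>e. e 0 \<in> X)"

lemma definable_mono: "definable M B X \<Longrightarrow> B \<subseteq> C \<Longrightarrow> definable M C X"
  unfolding definable_def by (rule dfn_mono)

lemma definable_Compl: "definable M B X \<Longrightarrow> definable M B (- X)"
  unfolding definable_def using dfn_not by fastforce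

lemma definable_Un: "definable M B X \<Longrightarrow> definable M B Y \<Longrightarrow> definable M B (X \<union> Y)"
  unfolding definable_def using dfn_disj by fastforce

lemma definable_Int: "definable M B X \<Longrightarrow> definable M B Y \<Longrightarrow> definable M B (X \<inter> Y)"
  unfolding definable_def using dfn_conj by fastforce

lemma definable_Diff: "definable M B X \<Longrightarrow> definable M B Y \<Longrightarrow> definable M B (X - Y)"
  unfolding Diff_eq by (intro definable_Int definable_Compl)

lemma definable_tm:
  assumes "tm_params t \<subseteq> B" "tm_vars t = {}"
  shows "definable M B {tm_val (\<lambda>_. 0) t}"
proof -
  have *: "tm_val e t = tm_val (\<lambda>_. 0) t" for e by (rule tm_val_cong) (use assms in auto)
  have "dfn M B (\<lambda>e. tm_val e (Var 0) = tm_val e t)" by (rule dfn_eq) (use assms in auto)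
  then show ?thesis unfolding definable_def
  proof (rule dfn_cong)
    show "(tm_val e (Var 0) = tm_val e t) = (e 0 \<in> {tm_val (\<lambda>_. 0) t})" for e
      using *[of e] by simp
  qed
qed

lemma definable_singleton: "b \<in> B \<Longrightarrow> definable M B {b}"
  using definable_tm[of "Cst b" B] by simp

lemma definable_zero: "definable M B {0}"
  using definable_tm[of Zero B] by simp

lemma definable_one: "definable M B {1}"
  using definable_tm[of One B] by simp

lemma definable_minus_one: "definable M B {-1}"
  using definable_tm[of "Neg One" B] by simp

lemma definable_UNIV: "definable M B UNIV"
  using definable_Un[OF definable_zero definable_Compl[OF definable_zero]] by simp

lemma definable_UN:
  assumes "finite F" "\<And>i. i \<in> F \<Longrightarrow> definable M B (X i)"
  shows "definable M B (\<Union>i\<in>F. X i)"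
  using assms
proof (induction F rule: finite_induct)
  case empty
  then show ?case using definable_Compl[OF definable_UNIV] by simp
qed (auto intro: definable_Un)

lemma definable_affine:
  assumes "definable M B X" "a \<in> B" "b \<in> B"
  shows "definable M B {x. a * x + b \<in> X}"
  using dfn_subst[of M B "\<lambda>e. e 0 \<in> X" "Add (Mul (Cst a) (Var 0)) (Cst b)" 0] assms
  unfolding definable_def by simp

lemma generic_set_iff: "generic_set X \<longleftrightarrow> (\<exists>T. finite T \<and> (\<forall>z. \<exists>t\<in>T. z + t \<in> X))"
proof
  assume "generic_set X"
  then obtain T where T: "finite T" "(\<Union>t\<in>T. (+) t ` X) = UNIV" unfolding generic_set_def by auto
  have "\<exists>t\<in>uminus ` T. z + t \<in> X" for z
  proof -
    have "z \<in> (\<Union>t\<in>T. (+) t ` X)" using T by simp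
    then show ?thesis by force
  qed
  then show "\<exists>T. finite T \<and> (\<forall>z. \<exists>t\<in>T. z + t \<in> X)" using T(1) by blast
next
  assume "\<exists>T. finite T \<and> (\<forall>z. \<exists>t\<in>T. z + t \<in> X)"
  then obtain T where T: "finite T" "\<forall>z. \<exists>t\<in>T. z + t \<in> X" by blast
  have "z \<in> (\<Union>t\<in>uminus ` T. (+) t ` X)" for z
  proof -
    obtain t where "t \<in> T" "z + t \<in> X" using T by blast
    then show ?thesis by (intro UN_I[of "-t"] image_eqI[of _ "(+) (- t)" "z + t"]) auto
  qed
  then show "generic_set X" using T(1) unfolding generic_set_def by blast
qed

lemma generic_setI: "finite T \<Longrightarrow> (\<And>z. \<exists>t\<in>T. z + t \<in> X) \<Longrightarrow> generic_set X"
  unfolding generic_set_iff by (intro exI[of _ T]) auto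

lemma generic_mono:
  assumes "generic_set X" "X \<subseteq> Y"
  shows "generic_set Y"
proof -
  obtain T where "finite T" "\<forall>z. \<exists>t\<in>T. z + t \<in> X"
    using assms(1) unfolding generic_set_iff by blast
  then show "generic_set Y" using assms(2) by (intro generic_setI[of T]) blast+
qed

lemma generic_UNIV: "generic_set UNIV"
  by (rule generic_setI[of "{0}"]) auto

lemma not_generic_empty: "\<not> generic_set {}"
  by (simp add: generic_set_iff)

text \<open>The shifts in \<open>T\<close> are divided by \<open>a\<close>; the converse is the same
  argument for the inverse affine map. So additive genericity is also invariant under
  scaling.\<close>

lemma generic_affine:
  fixes X :: "'a::field set"
  assumes "a \<noteq> 0"
  shows "generic_set {x. a * x + b \<in> X} \<longleftrightarrow> generic_set X"
proof -
  have *: "generic_set {x. a * x + b \<in> X}" if gen: "generic_set X" and "a \<noteq> 0" for a b :: 'a and X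
  proof -
    obtain T where T: "finite T" "\<forall>z. \<exists>t\<in>T. z + t \<in> X" using gen unfolding generic_set_iff by blast
    have "\<exists>t\<in>(\<lambda>t. t / a) ` T. z + t \<in> {x. a * x + b \<in> X}" for z
    proof -
      obtain t where "t \<in> T" "(a * z + b) + t \<in> X" using T by blast
      moreover have "a * (z + t / a) + b = (a * z + b) + t" using that(2) by (simp add: field_simps)
      ultimately have "a * (z + t / a) + b \<in> X" by (simp only:)
      then show ?thesis using \<open>t \<in> T\<close> by blast
    qed
    then show ?thesis using T(1) by (intro generic_setI[of "(\<lambda>t. t / a) ` T"]) simp
  qed
  have "{x. (1 / a) * x + (- b / a) \<in> {x. a * x + b \<in> X}} = X"
    using assms by (auto simp: field_simps)
  then show ?thesis using * [of X a b] *[of "{x. a * x + b \<in> X}" "1 / a" "- b / a"] assms by auto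
qed

section \<open>The ideal of nongeneric definable sets\<close>

locale stable_field =
  fixes M :: "('r, 'a::field) struct"
  assumes infinite_UNIV: "infinite (UNIV :: 'a set)" and stable: "stable_struct M"
begin

text \<open>The ladders of sums, products and affine maps built later are all instances of this
  family.\<close>

lemma affine_no_ladder:
  assumes "definable M UNIV X"
  shows "\<exists>n. \<not> ladder (\<lambda>x y. fst y * x + snd y \<in> X) n"
proof -
  have "dfn M UNIV (\<lambda>e. e 1 * e 0 + e 2 \<in> X)"
    using dfn_subst[of M UNIV "\<lambda>e. e 0 \<in> X" "Add (Mul (Var 1) (Var 0)) (Var 2)" 0] assms
    unfolding definable_def by simp
  from stable_no_ladder[OF stable this, of "\<lambda>y. case_nat (fst y) (\<lambda>_. snd y)"]
  show ?thesis by (simp add: numeral_2_eq_2)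
qed

text \<open>If neither is generic, finitely many translates of either leave points uncovered, and
  these extend a ladder for \<open>x + y \<in> X\<close> on alternate sides.\<close>

lemma generic_or_generic_Compl:
  assumes "definable M UNIV X"
  shows "generic_set X \<or> generic_set (- X)"
proof (rule ccontr)
  assume *: "\<not> (generic_set X \<or> generic_set (- X))"
  have "ladder (\<lambda>x y. x + y \<in> X) n" for n
  proof (rule ladderI_alternate)
    show "\<exists>y\<in>UNIV. \<forall>x\<in>S. x + y \<in> X" if "finite S" for S
      using * that unfolding generic_set_iff by (metis Compl_iff UNIV_I add.commute)
    show "\<exists>x\<in>UNIV. \<forall>y\<in>S. x + y \<notin> X" if "finite S" for S
      using * that unfolding generic_set_iff by (metis UNIV_I)
  qed
  then have "ladder (\<lambda>x y. fst y * x + snd y \<in> X) n" for n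
    using ladder_comp[of "\<lambda>x y. fst y * x + snd y \<in> X" "\<lambda>y. (1, y)" n] by simp
  then show False using affine_no_ladder[OF assms] by blast
qed

lemma generic_finite_shifts:
  assumes "generic_set {z. \<exists>t\<in>T. z + t \<in> X}" "finite T"
  shows "generic_set (X :: 'a set)"
proof -
  obtain U where U: "finite U" "\<forall>z. \<exists>u\<in>U. \<exists>t\<in>T. z + u + t \<in> X"
    using assms(1) unfolding generic_set_iff by auto
  have "\<exists>v\<in>(\<lambda>(u, t). u + t) ` (U \<times> T). z + v \<in> X" for z
  proof -
    obtain u t where "u \<in> U" "t \<in> T" "z + u + t \<in> X" using U by blast
    then show ?thesis by (intro bexI[of _ "u + t"]) (auto simp: add.assoc)
  qed
  then show ?thesis using U(1) assms(2)
    by (intro generic_setI[of "(\<lambda>(u, t). u + t) ` (U \<times> T)"]) simp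
qed

lemma definable_shifts:
  assumes "definable M UNIV X" "finite T"
  shows "definable M UNIV {z. \<exists>t\<in>T. z + t \<in> X}"
proof -
  have "{z. \<exists>t\<in>T. z + t \<in> X} = (\<Union>t\<in>T. {z. 1 * z + t \<in> X})" by auto
  also have "definable M UNIV \<dots>"
    by (intro definable_UN definable_affine assms) auto
  finally show ?thesis .
qed

text \<open>The points that some \<open>t \<in> T\<close> carries into \<open>X\<close> form a
  definable set. It or its complement is generic, and points of the complement are carried into
  \<open>Y\<close>.\<close>

lemma generic_Un:
  assumes "definable M UNIV X" "generic_set (X \<union> Y)"
  shows "generic_set X \<or> generic_set Y"
proof -
  obtain T where T: "finite T" "\<forall>z. \<exists>t\<in>T. z + t \<in> X \<union> Y"
    using assms(2) unfolding generic_set_iff by blast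
  let ?X = "{z. \<exists>t\<in>T. z + t \<in> X}" and ?Y = "{z. \<exists>t\<in>T. z + t \<in> Y}"
  have "- ?X \<subseteq> ?Y" using T(2) by blast
  then have "generic_set ?X \<or> generic_set ?Y"
    using generic_or_generic_Compl[OF definable_shifts[OF assms(1) T(1)]] generic_mono by blast
  then show ?thesis using generic_finite_shifts T(1) by blast
qed

lemma generic_UN:
  assumes "finite F" "\<And>i. i \<in> F \<Longrightarrow> definable M UNIV (X i)" "generic_set (\<Union>i\<in>F. X i)"
  shows "\<exists>i\<in>F. generic_set (X i)"
  using assms
proof (induction F rule: finite_induct)
  case empty
  then show ?case by (simp add: not_generic_empty)
next
  case (insert i F)
  then have "generic_set (X i) \<or> generic_set (\<Union>i\<in>F. X i)" by (intro generic_Un) auto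
  then show ?case using insert by auto
qed

lemma not_generic_finite: "finite X \<Longrightarrow> \<not> generic_set (X :: 'a set)"
proof
  assume "finite X" "generic_set X"
  then obtain T where T: "finite T" "(\<Union>t\<in>T. (+) t ` X) = UNIV" unfolding generic_set_def by auto
  then have "finite (UNIV :: 'a set)" using \<open>finite X\<close> by (metis finite_UN finite_imageI)
  then show False using infinite_UNIV by simp
qed

section \<open>Affine preimages modulo nongeneric sets\<close>

definition affpre :: "'a set \<Rightarrow> 'a \<times> 'a \<Rightarrow> 'a set" where
  "affpre X y = {x. fst y * x + snd y \<in> X}"

lemma definable_affpre: "definable M UNIV X \<Longrightarrow> definable M UNIV (affpre X y)"
  unfolding affpre_def by (rule definable_affine) auto

text \<open>Otherwise every generic definable set is split by an affine preimage of nonzero slope,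
  and \<open>ladderI_split\<close>, with the generic definable sets as positive ones, yields ladders
  of every length.\<close>

lemma ex_unsplit_generic:
  assumes X: "definable M UNIV X"
  shows "\<exists>Z. definable M UNIV Z \<and> generic_set Z \<and>
    (\<forall>y. fst y \<noteq> 0 \<longrightarrow> \<not> (generic_set (Z \<inter> affpre X y) \<and> generic_set (Z - affpre X y)))"
proof (rule ccontr)
  assume neg: "\<not> ?thesis"
  let ?pos = "\<lambda>Z. definable M UNIV Z \<and> generic_set Z"
  have "ladder (\<lambda>x y. x \<in> affpre X y) n" for n
  proof (rule ladderI_split[where pos = ?pos and Zinit = UNIV and Y = "{y. fst y \<noteq> 0}"])
    show "?pos UNIV" using generic_UNIV definable_UNIV by blast
    show "Z \<noteq> {}" if "?pos Z" for Z using that not_generic_empty by auto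
    show "\<exists>y\<in>{y. fst y \<noteq> 0}. ?pos (Z \<inter> affpre X y) \<and> ?pos (Z - affpre X y)" if Z: "?pos Z" for Z
    proof -
      obtain y where "fst y \<noteq> 0" "generic_set (Z \<inter> affpre X y)" "generic_set (Z - affpre X y)"
        using neg Z by blast
      moreover have "definable M UNIV (Z \<inter> affpre X y)" "definable M UNIV (Z - affpre X y)"
        using that by (auto intro: definable_affpre[OF X] definable_Int definable_Diff)
      ultimately show ?thesis by blast
    qed
    show "?pos (Z \<inter> affpre X y) \<and> ?pos (Z - affpre X y)"
      if "?pos Z" "?pos Z'" "Z' \<subseteq> Z" "?pos (Z' \<inter> affpre X y) \<and> ?pos (Z' - affpre X y)" for Z Z' y
    proof (intro conjI definable_Int definable_Diff definable_affpre X)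
      show "generic_set (Z \<inter> affpre X y)"
        by (rule generic_mono[of "Z' \<inter> affpre X y"]) (use that in auto)
      show "generic_set (Z - affpre X y)"
        by (rule generic_mono[of "Z' - affpre X y"]) (use that in auto)
    qed (use that in auto)
  qed
  then show False using affine_no_ladder[OF X] by (simp add: affpre_def)
qed

definition eqv :: "'a set \<Rightarrow> 'a set \<Rightarrow> bool" where
  "eqv U V \<longleftrightarrow> \<not> generic_set (U - V) \<and> \<not> generic_set (V - U)"

lemma eqv_sym: "eqv U V \<Longrightarrow> eqv V U"
  unfolding eqv_def by blast

lemma eqv_trans:
  assumes "definable M UNIV U" "definable M UNIV V" "definable M UNIV W" "eqv U V" "eqv V W"
  shows "eqv U W"
proof -
  have "\<not> generic_set (A - C)" if "definable M UNIV A" "definable M UNIV B"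
    "\<not> generic_set (A - B)" "\<not> generic_set (B - C)" for A B C
    using generic_Un[OF definable_Diff[OF that(1,2)], of "B - C"] generic_mono[of "A - C" "(A - B) \<union> (B - C)"] that(3,4)
    by blast
  then show ?thesis using assms unfolding eqv_def by blast
qed

lemma eqv_affpre:
  assumes "a \<noteq> 0" "eqv U V"
  shows "eqv (affpre U (a, b)) (affpre V (a, b))"
proof -
  have "affpre U (a, b) - affpre V (a, b) = {x. a * x + b \<in> U - V}" for U V
    by (auto simp: affpre_def)
  then show ?thesis using assms(2) by (simp only: eqv_def generic_affine[OF assms(1)] not_False_eq_True)
qed

lemma affpre_affpre: "affpre (affpre X (a, b)) (c, d) = affpre X (a * c, a * d + b)"
  by (simp add: affpre_def algebra_simps)

lemma affpre_id: "affpre X (1, 0) = X"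
  by (simp add: affpre_def)

text \<open>Modulo nongeneric sets there are only finitely many affine preimages of \<open>X\<close>, and the
  translations that fix all of them form an ideal of finite index, hence the whole field.\<close>

lemma eqv_translate:
  assumes X: "definable M UNIV X"
  shows "eqv (affpre X (1, b)) X"
proof (cases "b = 0")
  case True
  then show ?thesis by (simp add: affpre_id eqv_def not_generic_empty)
next
  case b: False
  note dX = definable_affpre[OF X]
  obtain Z where Z: "definable M UNIV Z" "generic_set Z"
    and unsplit: "\<And>y. fst y \<noteq> 0 \<Longrightarrow> \<not> (generic_set (Z \<inter> affpre X y) \<and> generic_set (Z - affpre X y))"
    using ex_unsplit_generic[OF X] by blast
  obtain T where T: "finite T" "\<forall>z. \<exists>t\<in>T. z + t \<in> Z"
    using Z(2) unfolding generic_set_iff by blast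
  have unsplit_t: "\<not> (generic_set (affpre Z (1, t) \<inter> affpre X y) \<and> generic_set (affpre Z (1, t) - affpre X y))"
    if "fst y \<noteq> 0" for t y
  proof -
    let ?y = "(fst y, snd y - fst y * t)"
    have "affpre Z (1, t) \<inter> affpre X y = {x. 1 * x + t \<in> Z \<inter> affpre X ?y}"
      "affpre Z (1, t) - affpre X y = {x. 1 * x + t \<in> Z - affpre X ?y}"
      by (auto simp: affpre_def algebra_simps)
    then show ?thesis using unsplit[of ?y] that generic_affine[of 1 t] by (metis fst_conv one_neq_zero)
  qed
  \<comment> \<open>As no translate of \<open>Z\<close> is split, the translates that meet a
    preimage in a generic set determine it modulo nongeneric sets. There are finitely many such
    codes.\<close>
  define code where "code = (\<lambda>y. {t \<in> T. generic_set (affpre Z (1, t) \<inter> affpre X y)})"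
  have code_sub: "\<not> generic_set (affpre X y - affpre X y')"
    if "code y = code y'" "fst y \<noteq> 0" "fst y' \<noteq> 0" for y y'
  proof
    assume "generic_set (affpre X y - affpre X y')"
    moreover have "affpre X y - affpre X y' \<subseteq> (\<Union>t\<in>T. affpre Z (1, t) \<inter> (affpre X y - affpre X y'))"
      using T(2) by (auto simp: affpre_def)
    ultimately have "generic_set (\<Union>t\<in>T. affpre Z (1, t) \<inter> (affpre X y - affpre X y'))"
      by (rule generic_mono)
    then obtain t where t: "t \<in> T" "generic_set (affpre Z (1, t) \<inter> (affpre X y - affpre X y'))"
      using generic_UN[OF T(1), of "\<lambda>t. affpre Z (1, t) \<inter> (affpre X y - affpre X y')"]
      by (auto intro: dX definable_affpre Z(1) definable_Int definable_Diff)
    have "generic_set (affpre Z (1, t) \<inter> affpre X y)" by (rule generic_mono[OF t(2)]) auto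
    then have "t \<in> code y'" using that(1) t(1) by (auto simp: code_def)
    then have "generic_set (affpre Z (1, t) \<inter> affpre X y')" by (simp add: code_def)
    moreover have "generic_set (affpre Z (1, t) - affpre X y')" by (rule generic_mono[OF t(2)]) auto
    ultimately show False using unsplit_t that by blast
  qed
  have code_eqv: "eqv (affpre X y) (affpre X y')" if "code y = code y'" "fst y \<noteq> 0" "fst y' \<noteq> 0" for y y'
    using code_sub[of y y'] code_sub[of y' y] that by (simp add: eqv_def)
  define rep where "rep = (\<lambda>k. SOME y. fst y \<noteq> 0 \<and> code y = k)"
  have rep: "fst (rep (code y)) \<noteq> 0 \<and> code (rep (code y)) = code y" if "fst y \<noteq> 0" for y
    unfolding rep_def by (rule someI[of _ y]) (use that in auto)
  let ?sh = "\<lambda>y b. (fst y, snd y + fst y * b)"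
  have sh: "affpre (affpre X y) (1, b) = affpre X (?sh y b)" for y b
    using affpre_affpre[of X "fst y" "snd y" 1 b] by (simp add: add.commute)
  \<comment> \<open>\<open>F b\<close> records how translation by \<open>b\<close> acts on the
    codes. Only finitely many actions exist, so two distinct translations act alike.\<close>
  define F where "F = (\<lambda>b. restrict (\<lambda>k. code (?sh (rep k) b)) (Pow T))"
  have code_Pow: "code y \<in> Pow T" for y by (auto simp: code_def)
  have "F b \<in> Pow T \<rightarrow>\<^sub>E Pow T" for b
    unfolding F_def restrict_PiE_iff using code_Pow by blast
  then have "F ` UNIV \<subseteq> Pow T \<rightarrow>\<^sub>E Pow T" by blast
  then have "finite (F ` UNIV)" using finite_PiE[of "Pow T" "\<lambda>_. Pow T"] T(1) finite_subset by auto
  then have "\<not> inj F" using finite_imageD infinite_UNIV by blast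
  then obtain b1 b2 where b12: "b1 \<noteq> b2" "F b1 = F b2" by (auto simp: inj_def)
  define d where "d = b1 - b2"
  have shift: "eqv (affpre X (?sh y b1)) (affpre X (?sh y b2))" if y: "fst y \<noteq> 0" for y
  proof -
    let ?r = "rep (code y)"
    have e: "eqv (affpre X y) (affpre X ?r)" using code_eqv rep[OF y] y by metis
    have e': "eqv (affpre X (?sh y b)) (affpre X (?sh ?r b))" for b
      using eqv_affpre[OF _ e, of 1 b] sh by simp
    have "code (?sh ?r b1) = code (?sh ?r b2)"
      using fun_cong[OF b12(2), of "code y"] code_Pow[of y] by (simp add: F_def)
    then have "eqv (affpre X (?sh ?r b1)) (affpre X (?sh ?r b2))"
      using code_eqv rep[OF y] by simp
    then show ?thesis using eqv_trans[OF dX dX dX] eqv_sym e' by meson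
  qed
  have d: "d \<noteq> 0" using b12 by (simp add: d_def)
  \<comment> \<open>Slope \<open>a\<close> stretches the shift by \<open>d\<close>, the difference
    of the two translations, to a shift by the given \<open>b\<close>; rescaling by
    \<open>1 / a\<close> then returns to slope one.\<close>
  define a where "a = b / d"
  have a: "a \<noteq> 0" "a * d = b" using b d by (auto simp: a_def)
  have "eqv (affpre X (a, a * d)) (affpre X (a, 0))"
    using shift[of "(a, - a * b2)"] a by (simp add: d_def algebra_simps)
  then have "eqv (affpre (affpre X (a, a * d)) (1 / a, 0)) (affpre (affpre X (a, 0)) (1 / a, 0))"
    using a by (intro eqv_affpre) auto
  then show ?thesis using a by (simp add: affpre_affpre affpre_id)
qed

text \<open>Finitely many translates of \<open>X\<close> cover \<open>- X\<close>, so one of them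
  would meet a generic \<open>- X\<close> in a generic set, against
  \<open>eqv_translate\<close>.\<close>

lemma generic_Compl_not_generic:
  assumes X: "definable M UNIV X" and "generic_set X"
  shows "\<not> generic_set (- X)"
proof
  assume g: "generic_set (- X)"
  obtain T where T: "finite T" "\<forall>z. \<exists>t\<in>T. z + t \<in> X"
    using assms(2) unfolding generic_set_iff by blast
  have dX: "definable M UNIV (affpre X y)" for y by (rule definable_affpre[OF X])
  have "- X \<subseteq> (\<Union>t\<in>T. affpre X (1, t) - X)" using T(2) by (auto simp: affpre_def)
  then have "generic_set (\<Union>t\<in>T. affpre X (1, t) - X)" by (rule generic_mono[OF g])
  then obtain t where "generic_set (affpre X (1, t) - X)"
    using generic_UN[OF T(1), of "\<lambda>t. affpre X (1, t) - X"] dX definable_Diff[OF _ X] by blast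
  then show False using eqv_translate[OF X] unfolding eqv_def by blast
qed

section \<open>Inversion and genericity\<close>

lemma definable_inverse:
  assumes "definable M B X"
  shows "definable M B {x. x \<noteq> 0 \<and> inverse x \<in> X}"
proof -
  have X: "dfn M B (\<lambda>e. e 1 \<in> X)"
    using dfn_rename[of M B "\<lambda>e. e 0 \<in> X" 0 1] assms unfolding definable_def by simp
  have "dfn M B (\<lambda>e. \<exists>a. tm_val (e(1 := a)) (Mul (Var 0) (Var 1)) = tm_val (e(1 := a)) One \<and> (e(1 := a)) 1 \<in> X)"
    by (rule dfn_ex[OF dfn_conj[OF dfn_eq X]]) auto
  then show ?thesis unfolding definable_def
  proof (rule dfn_cong)
    fix e :: "nat \<Rightarrow> 'a"
    have "e 0 * a = 1 \<longleftrightarrow> e 0 \<noteq> 0 \<and> a = inverse (e 0)" for a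
      by (metis inverse_unique mult_zero_left right_inverse zero_neq_one)
    then show "(\<exists>a. tm_val (e(1 := a)) (Mul (Var 0) (Var 1)) = tm_val (e(1 := a)) One \<and> (e(1 := a)) 1 \<in> X) =
       (e 0 \<in> {x. x \<noteq> 0 \<and> inverse x \<in> X})" by simp
  qed
qed

text \<open>If \<open>X\<close> is nongeneric and \<open>?Y\<close> generic, then
  \<open>- ?Y\<close> is nongeneric too. Finitely many multiples of either nongeneric set leave
  nonzero elements uncovered, and these build a ladder for \<open>x * y \<in> ?Y\<close>.\<close>

lemma generic_inverse:
  assumes X: "definable M UNIV X" and gen: "generic_set {x. x \<noteq> 0 \<and> inverse x \<in> X}"
  shows "generic_set X"
proof (rule ccontr)
  assume ng: "\<not> generic_set X"
  let ?Y = "{x. x \<noteq> 0 \<and> inverse x \<in> X}"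
  note Y = definable_inverse[OF X]
  \<comment> \<open>Scaling preserves additive genericity and \<open>{0}\<close> is nongeneric, so a
    set whose multiples cover all nonzero elements is generic.\<close>
  have cover: "\<exists>t\<in>T. generic_set W" if T: "finite T" "0 \<notin> T" and W': "definable M UNIV W" and
    W: "\<And>x. x \<noteq> 0 \<Longrightarrow> \<exists>t\<in>T. t * x \<in> W" for T W
  proof -
    have "generic_set ({0} \<union> (\<Union>t\<in>T. affpre W (t, 0)))"
      by (rule generic_mono[OF generic_UNIV]) (use W in \<open>auto simp: affpre_def\<close>)
    then have "generic_set (\<Union>t\<in>T. affpre W (t, 0))"
      using generic_Un[OF definable_zero] not_generic_finite[of "{0}"] by blast
    then obtain t where "t \<in> T" "generic_set (affpre W (t, 0))"
      using generic_UN[OF T(1), of "\<lambda>t. affpre W (t, 0)"] definable_affpre[OF W'] by blast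
    then show ?thesis using generic_affine[of t 0 W] T(2) by (auto simp: affpre_def)
  qed
  have "ladder (\<lambda>x y. x * y \<in> ?Y) n" for n
  proof (rule ladderI_alternate[where A = "- {0}" and C = "- {0}"])
    fix S :: "'a set" assume S: "finite S" "S \<subseteq> - {0}"
    show "\<exists>y\<in>- {0}. \<forall>x\<in>S. x * y \<in> ?Y"
      using cover[of S "- ?Y"] S definable_Compl[OF Y] generic_Compl_not_generic[OF Y gen] by blast
    have inv: "0 \<notin> inverse ` S" using S by (auto dest: sym)
    show "\<exists>x\<in>- {0}. \<forall>y\<in>S. x * y \<notin> ?Y"
    proof (rule ccontr)
      assume neg: "\<not> ?thesis"
      have "\<exists>t\<in>inverse ` S. t * x \<in> X" if "x \<noteq> 0" for x
      proof -
        have "inverse x \<in> - {0}" using that by simp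
        then obtain y where "y \<in> S" "inverse x * y \<in> ?Y" using neg by blast
        then show ?thesis by (auto simp: mult.commute)
      qed
      then show False using cover[of "inverse ` S" X] S inv X ng by blast
    qed
  qed
  then have "ladder (\<lambda>x y. fst y * x + snd y \<in> ?Y) n" for n
    using ladder_comp[of "\<lambda>x y. fst y * x + snd y \<in> ?Y" "\<lambda>y. (y, 0)" n] by (simp add: mult.commute)
  then show False using affine_no_ladder[OF Y] by blast
qed

end

section \<open>Generic elements\<close>

lemma definable_defset: "\<phi> \<in> formulas_over B \<Longrightarrow> definable M B (defset M \<phi>)"
  unfolding definable_def dfn_def formulas_over_def defset_def
  by (intro exI[of _ \<phi>]) (auto intro!: sat_cong)

text \<open>Variables other than \<open>0\<close> do not affect the truth value, so quantifying them
  existentially removes them without changing the set.\<close>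

lemma definableE:
  assumes "definable M B X"
  obtains \<phi> where "\<phi> \<in> formulas_over B" "defset M \<phi> = X"
proof -
  have *: "\<exists>\<psi>. params \<psi> \<subseteq> B \<and> (\<forall>e. sat M e \<psi> = (e 0 \<in> X)) \<and> fv \<psi> \<subseteq> {0}"
    if "finite F" "params \<phi> \<subseteq> B" "\<forall>e. sat M e \<phi> = (e 0 \<in> X)" "fv \<phi> \<subseteq> insert 0 F" for F \<phi>
    using that
  proof (induction F arbitrary: \<phi> rule: finite_induct)
    case (insert n F)
    show ?case
    proof (cases "n = 0")
      case True
      then show ?thesis using insert by auto
    next
      case False
      then show ?thesis using insert.prems by (intro insert.IH[of "FEx n \<phi>"]) auto
    qed
  qed blast
  obtain \<phi> where "params \<phi> \<subseteq> B" "\<forall>e. sat M e \<phi> = (e 0 \<in> X)"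
    using assms unfolding definable_def dfn_def by blast
  then obtain \<psi> where "params \<psi> \<subseteq> B" "\<forall>e. sat M e \<psi> = (e 0 \<in> X)" "fv \<psi> \<subseteq> {0}"
    using *[OF finite_fv[of \<phi>]] by blast
  then show ?thesis by (intro that[of \<psi>]) (auto simp: formulas_over_def defset_def)
qed

lemma generic_over_iff:
  "generic_over M B g \<longleftrightarrow> (\<forall>X. definable M B X \<longrightarrow> g \<in> X \<longrightarrow> generic_set X)"
proof
  assume g: "generic_over M B g"
  show "\<forall>X. definable M B X \<longrightarrow> g \<in> X \<longrightarrow> generic_set X"
  proof (intro allI impI)
    fix X assume "definable M B X" "g \<in> X"
    then obtain \<phi> where "\<phi> \<in> formulas_over B" "defset M \<phi> = X" by (metis definableE)
    then show "generic_set X"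
      using g \<open>g \<in> X\<close> unfolding generic_over_def generic_type_def tp_def by auto
  qed
next
  assume "\<forall>X. definable M B X \<longrightarrow> g \<in> X \<longrightarrow> generic_set X"
  then show "generic_over M B g"
    unfolding generic_over_def generic_type_def tp_def using definable_defset by auto
qed

lemma generic_overD: "generic_over M B g \<Longrightarrow> definable M B X \<Longrightarrow> g \<in> X \<Longrightarrow> generic_set X"
  unfolding generic_over_iff by blast

lemma generic_over_anti: "generic_over M C g \<Longrightarrow> B \<subseteq> C \<Longrightarrow> generic_over M B g"
  unfolding generic_over_iff using definable_mono by blast

definition nongeneric :: "('r, 'a::field) struct \<Rightarrow> 'a set \<Rightarrow> 'a set" where
  "nongeneric M B = {x. \<not> generic_over M B x}"

lemma nongeneric_iff:
  "x \<in> nongeneric M B \<longleftrightarrow> (\<exists>X. definable M B X \<and> x \<in> X \<and> \<not> generic_set X)"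
  unfolding nongeneric_def generic_over_iff by auto

lemma nongeneric_mono: "B \<subseteq> C \<Longrightarrow> nongeneric M B \<subseteq> nongeneric M C"
  unfolding nongeneric_def using generic_over_anti by blast

lemma definable_preimage:
  assumes X: "definable M B X" and t: "tm_params t \<subseteq> B" "tm_vars t \<subseteq> {0}"
  shows "definable M B {x. tm_val (\<lambda>_. x) t \<in> X}"
  unfolding definable_def
proof (rule dfn_cong)
  show "dfn M B (\<lambda>e. (e(0 := tm_val e t)) 0 \<in> X)"
    using dfn_subst[OF X[unfolded definable_def] t(1), of 0] .
  show "((e(0 := tm_val e t)) 0 \<in> X) = (e 0 \<in> {x. tm_val (\<lambda>_. x) t \<in> X})" for e
  proof -
    have "tm_val e t = tm_val (\<lambda>_. e 0) t" by (rule tm_val_cong) (use t(2) in auto)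
    then show ?thesis by simp
  qed
qed

lemma definable_mult:
  "definable M B X \<Longrightarrow> a \<in> B \<Longrightarrow> definable M B {x. a * x \<in> X}"
  using definable_preimage[of M B X "Mul (Cst a) (Var 0)"] by simp

lemma definable_diff:
  "definable M B X \<Longrightarrow> b \<in> B \<Longrightarrow> definable M B {x. x - b \<in> X}"
  using definable_preimage[of M B X "Add (Var 0) (Neg (Cst b))"] by simp

lemma generic_over_mult:
  assumes "generic_over M B g" "a \<in> B" "a \<noteq> 0"
  shows "generic_over M B (a * g)"
  unfolding generic_over_iff
proof (intro allI impI)
  fix X assume X: "definable M B X" "a * g \<in> X"
  have "generic_set {x. a * x \<in> X}"
    using generic_overD[OF assms(1) definable_mult[OF X(1) assms(2)]] X(2) by simp
  then show "generic_set X" using generic_affine[OF assms(3), of 0 X] by simp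
qed

lemma generic_over_diff:
  assumes "generic_over M B g" "b \<in> B"
  shows "generic_over M B (g - b)"
  unfolding generic_over_iff
proof (intro allI impI)
  fix X assume X: "definable M B X" "g - b \<in> X"
  have "generic_set {x. x - b \<in> X}"
    using generic_overD[OF assms(1) definable_diff[OF X(1) assms(2)]] X(2) by simp
  then show "generic_set X" using generic_affine[of 1 "- b" X] by simp
qed

section \<open>Definable binary relations and their fibres\<close>

definition dfn2 :: "('r, 'a::field) struct \<Rightarrow> 'a set \<Rightarrow> ('a \<Rightarrow> 'a \<Rightarrow> bool) \<Rightarrow> bool" where
  "dfn2 M B R \<longleftrightarrow> dfn M B (\<lambda>e. R (e 0) (e 1))"

lemma dfn2_swap:
  assumes "dfn2 M B R"
  shows "dfn2 M B (\<lambda>x y. R y x)"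
proof -
  have "dfn M B (\<lambda>e. R (e 1) (e 2))"
    using dfn_rename[OF dfn_rename[OF assms[unfolded dfn2_def], of 0 2], of 1 0] 
      dfn_rename[OF dfn_rename[OF assms[unfolded dfn2_def], of 1 2], of 0 1] by simp
  from dfn_rename[OF this, of 2 0] show ?thesis unfolding dfn2_def by simp
qed

lemma dfn2_fibre:
  assumes "dfn2 M B R" "B \<subseteq> C" "y \<in> C"
  shows "definable M C {x. R x y}"
  using dfn_inst[OF dfn_mono[OF assms(1)[unfolded dfn2_def] assms(2)] assms(3), of 1]
  unfolding definable_def by simp

lemma definable_insertE:
  fixes M :: "('r, 'a::field) struct"
  assumes "definable M (insert u B) X"
  obtains R where "dfn2 M B R" "X = {x. R x u}"
proof -
  obtain Q m where Q: "dfn M B Q" "1 \<le> m" "\<And>e. (e 0 \<in> X) = Q (e(m := u))"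
    using dfn_insertE[OF assms[unfolded definable_def], of 1] by metis
  \<comment> \<open>When variable \<open>m\<close> is not \<open>u\<close>, \<open>Q\<close> may
    depend on variables besides \<open>0\<close> and \<open>m\<close>. Overwriting them by
    \<open>e 0\<close>, one at a time, leaves a binary relation whose fibre at \<open>u\<close> is
    still \<open>X\<close>.\<close>
  have collapse: "dfn M B (\<lambda>e. Q (\<lambda>v. if v < k \<and> v \<noteq> m then e 0 else e v))" for k
  proof (induction k)
    case 0
    then show ?case using Q(1) by simp
  next
    case (Suc k)
    show ?case
    proof (cases "k = m \<or> k = 0")
      case True
      then have "(\<lambda>v. if v < k \<and> v \<noteq> m then e 0 else e v) = (\<lambda>v. if v < Suc k \<and> v \<noteq> m then e 0 else e v)"
        for e :: "nat \<Rightarrow> 'a" by (auto simp: less_Suc_eq)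
      then show ?thesis using dfn_cong[OF Suc] by simp
    next
      case False
      then have "(\<lambda>v. if v < k \<and> v \<noteq> m then (e(k := e 0)) 0 else (e(k := e 0)) v)
          = (\<lambda>v. if v < Suc k \<and> v \<noteq> m then e 0 else e v)" for e :: "nat \<Rightarrow> 'a"
        by (auto simp: less_Suc_eq)
      then show ?thesis using dfn_rename[OF Suc, of k 0] by simp
    qed
  qed
  obtain N where N: "\<forall>e e'. (\<forall>v<N. e v = e' v) \<longrightarrow> Q e = Q e'"
    using dfn_finite_support[OF Q(1)] ..
  have "dfn M B (\<lambda>e. Q ((\<lambda>_. e 0)(m := e m)))"
    by (rule dfn_cong[OF collapse[of N]], intro N[rule_format]) auto
  from dfn_rename[OF this, of m 1] have "dfn2 M B (\<lambda>x y. Q ((\<lambda>_. x)(m := y)))"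
    unfolding dfn2_def using Q(2) by simp
  moreover have "x \<in> X \<longleftrightarrow> Q ((\<lambda>_. x)(m := u))" for x using Q(3)[of "\<lambda>_. x"] by simp
  then have "X = {x. Q ((\<lambda>_. x)(m := u))}" by blast
  ultimately show ?thesis by (rule that)
qed

text \<open>Being covered by \<open>n\<close> translates is first order. In the induction
  \<open>P\<close> collects the points covered by translates already quantified, and each step adds
  one translate.\<close>

lemma dfn_covered:
  assumes R: "dfn2 M B R" and P: "dfn M B P"
  shows "dfn M B (\<lambda>e. \<exists>ts. length ts = n \<and> (\<forall>z. P (e(1 := z)) \<or> (\<exists>t\<in>set ts. R (e 0) (z + t))))"
  using P
proof (induction n arbitrary: P)
  case 0
  show ?case by (rule dfn_cong[OF dfn_all[OF "0.prems", of 1]]) auto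
next
  case (Suc n)
  obtain N where N: "\<forall>e e'. (\<forall>v<N. e v = e' v) \<longrightarrow> P e = P e'"
    using dfn_finite_support[OF Suc.prems] ..
  \<comment> \<open>The new variable lies beyond the support of \<open>P\<close> and differs from
    \<open>0\<close> and \<open>1\<close>.\<close>
  define m where "m = N + 2"
  have Pm: "P (e(m := t, 1 := z)) = P (e(1 := z))" for e t z
    by (rule N[rule_format]) (simp add: m_def)
  let ?P = "\<lambda>e. P e \<or> R (e 0) (e 1 + e m)"
  have "dfn M B (\<lambda>e. R (e 0) (e 1 + e m))"
    using dfn_subst[OF R[unfolded dfn2_def], of "Add (Var 1) (Var m)" 1] by simp
  from dfn_ex[OF Suc.IH[OF dfn_disj[OF Suc.prems this]], of m]
  show ?case
  proof (rule dfn_cong)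
    fix e
    show "(\<exists>t ts. length ts = n \<and> (\<forall>z. ?P ((e(m := t))(1 := z)) \<or> (\<exists>t'\<in>set ts. R ((e(m := t)) 0) (z + t'))))
      = (\<exists>ts. length ts = Suc n \<and> (\<forall>z. P (e(1 := z)) \<or> (\<exists>t\<in>set ts. R (e 0) (z + t))))"
      (is "?L = ?R")
    proof -
      have "?R = (\<exists>t ts. length ts = n \<and> (\<forall>z. P (e(1 := z)) \<or> (\<exists>t'\<in>set (t # ts). R (e 0) (z + t'))))"
        unfolding length_Suc_conv by blast
      also have "\<dots> = ?L" by (simp only: Pm) (simp add: m_def disj_assoc)
      finally show ?thesis ..
    qed
  qed
qed

lemma definable_covered:
  assumes "dfn2 M B R"
  shows "definable M B {x. \<exists>ts. length ts = n \<and> (\<forall>z. \<exists>t\<in>set ts. R x (z + t))}"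
proof -
  have "dfn M B (\<lambda>_. False)" using dfn_not[OF dfn_eq[of "Var 0" B "Var 0"]] by simp
  from dfn_covered[OF assms this] show ?thesis unfolding definable_def by simp
qed

section \<open>Uniqueness of the generic type over a set\<close>

context stable_field
begin

text \<open>Otherwise \<open>X\<close> and \<open>- X\<close> would both be generic.\<close>

lemma generic_over_same:
  assumes "generic_over M B g" "generic_over M B g'" "definable M B X" "g \<in> X"
  shows "g' \<in> X"
proof (rule ccontr)
  assume "g' \<notin> X"
  then have "generic_set (- X)" using generic_overD[OF assms(2) definable_Compl[OF assms(3)]] by simp
  then show False
    using generic_overD[OF assms(1,3,4)] generic_Compl_not_generic definable_mono[OF assms(3)] by blast
qed

text \<open>That a fibre is covered by a given number of translates is a condition definable over
  \<open>B\<close>, and all generics over \<open>B\<close> satisfy the same conditions.\<close>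

lemma generic_fibre_same:
  assumes R: "dfn2 M B R" and g: "generic_over M B g" and x: "generic_over M B x"
    and gen: "generic_set {y. R g y}"
  shows "generic_set {y. R x y}"
proof -
  obtain T where T: "finite T" "\<forall>z. \<exists>t\<in>T. z + t \<in> {y. R g y}"
    using gen unfolding generic_set_iff by blast
  obtain ts where ts: "set ts = T" using finite_list[OF T(1)] by blast
  let ?E = "{x. \<exists>us. length us = length ts \<and> (\<forall>z. \<exists>t\<in>set us. R x (z + t))}"
  have "g \<in> ?E" using T ts by auto
  then have "x \<in> ?E" by (rule generic_over_same[OF g x definable_covered[OF R]])
  then obtain us where "\<forall>z. \<exists>t\<in>set us. R x (z + t)" by blast
  then show ?thesis by (intro generic_setI[of "set us"]) auto
qed

lemma no_ladder_dfn2: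
  assumes "dfn2 M B R"
  shows "\<exists>n. \<not> ladder R n"
  using stable_no_ladder[OF stable dfn_mono[OF assms[unfolded dfn2_def] subset_UNIV], of "\<lambda>y _. y"]
  by simp

end

section \<open>Existence and symmetry of generics in a monster model\<close>

locale monster_field = stable_field M for M :: "('r, 'a::field) struct" +
  fixes \<kappa> :: "'c rel"
  assumes monster: "monster_model \<kappa> M"
begin

lemma small_finite: "finite S \<Longrightarrow> small \<kappa> S"
  using monster ordLess_transitive finite_iff_ordLess_natLeq
  unfolding small_def monster_model_def by blast

lemma small_Un:
  includes cardinal_syntax
  assumes "small \<kappa> B" "small \<kappa> C"
  shows "small \<kappa> (B \<union> C)"
proof -
  have \<kappa>: "Card_order \<kappa>" "natLeq <o \<kappa>" using monster unfolding monster_model_def by auto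
  have "infinite (Field \<kappa>)"
  proof
    assume "finite (Field \<kappa>)"
    then have "|Field \<kappa>| <o natLeq" using finite_iff_ordLess_natLeq by blast
    then have "\<kappa> <o natLeq" using card_of_Field_ordIso[OF \<kappa>(1)] ordIso_symmetric ordIso_ordLess_trans by blast
    then show False using \<kappa>(2) ordLess_transitive ordLess_irreflexive by blast
  qed
  then show ?thesis using card_of_Un_ordLess_infinite_Field \<kappa>(1) assms unfolding small_def by blast
qed

lemma small_insert: "small \<kappa> B \<Longrightarrow> small \<kappa> (insert b B)"
  using small_Un[of "{b}" B] small_finite[of "{b}"] by simp

text \<open>Saturation realises the formulas whose negations define nongeneric sets. They are
  finitely satisfiable, since finitely many nongeneric definable sets do not cover the
  field.\<close>

lemma ex_generic_over:
  assumes B: "small \<kappa> B"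
  shows "\<exists>x. generic_over M B x"
proof -
  define p where "p = {\<phi> \<in> formulas_over B. \<not> generic_set (- defset M \<phi>)}"
  have fin: "\<exists>x. \<forall>\<phi>\<in>q. x \<in> defset M \<phi>" if q: "finite q" "q \<subseteq> p" for q
  proof (rule ccontr)
    assume "\<not> ?thesis"
    then have "(\<Union>\<phi>\<in>q. - defset M \<phi>) = UNIV" by auto
    then have "\<exists>\<phi>\<in>q. generic_set (- defset M \<phi>)"
      using q generic_UNIV
      by (intro generic_UN) (auto simp: p_def intro!: definable_Compl definable_mono[OF definable_defset])
    then show False using q(2) by (auto simp: p_def)
  qed
  have "p \<subseteq> formulas_over B" by (auto simp: p_def)
  then obtain x where x: "\<forall>\<phi>\<in>p. x \<in> defset M \<phi>"
    using monster B fin unfolding monster_model_def saturated_def by blast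
  have "generic_over M B x"
    unfolding generic_over_iff
  proof (intro allI impI, rule ccontr)
    fix X assume X: "definable M B X" "x \<in> X" "\<not> generic_set X"
    obtain \<phi> where "\<phi> \<in> formulas_over B" "defset M \<phi> = - X"
      using definableE[OF definable_Compl[OF X(1)]] by metis
    then show False using x X(2,3) by (auto simp: p_def)
  qed
  then show ?thesis ..
qed

text \<open>If \<open>g\<close> lay in a nongeneric fibre at \<open>u\<close>, then
  \<open>{y. R x y}\<close> would be generic for every \<open>x\<close> generic over
  \<open>B\<close>, and \<open>{x. R x y}\<close> nongeneric for every such \<open>y\<close>. An
  element generic over \<open>B\<close> and the earlier points could then extend a ladder on either
  side.\<close>

lemma generic_over_sym:
  assumes B: "small \<kappa> B" and g: "generic_over M B g" and u: "generic_over M (insert g B) u"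
  shows "generic_over M (insert u B) g"
  unfolding generic_over_iff
proof (intro allI impI, rule ccontr)
  fix X assume X: "definable M (insert u B) X" "g \<in> X" "\<not> generic_set X"
  obtain R where R: "dfn2 M B R" "X = {x. R x u}" using definable_insertE[OF X(1)] by metis
  note R' = dfn2_swap[OF R(1)]
  have uB: "generic_over M B u" using generic_over_anti[OF u] by blast
  have "definable M (insert g B) {y. R g y}" using dfn2_fibre[OF R', of "insert g B" g] by auto
  then have gen_g: "generic_set {y. R g y}" using generic_overD[OF u] X(2) R(2) by simp
  have ngen_u: "\<not> generic_set {x. R x y}" if "generic_over M B y" for y
    using generic_fibre_same[OF R' that uB] X(3) R(2) by blast
  let ?A = "{x. generic_over M B x}"
  have "ladder R n" for n
  proof (rule ladderI_alternate[where A = ?A and C = ?A])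
    fix S assume S: "finite S" "S \<subseteq> ?A"
    obtain z where z: "generic_over M (B \<union> S) z"
      using ex_generic_over[OF small_Un[OF B small_finite[OF S(1)]]] ..
    have zB: "z \<in> ?A" using generic_over_anti[OF z] by blast
    have "R x z" if "x \<in> S" for x
    proof (rule ccontr)
      assume neg: "\<not> R x z"
      have d: "definable M (B \<union> S) {y. R x y}" using dfn2_fibre[OF R', of "B \<union> S" x] that by auto
      have "generic_set (- {y. R x y})" using generic_overD[OF z definable_Compl[OF d]] neg by simp
      moreover have "generic_set {y. R x y}"
        using generic_fibre_same[OF R(1) g _ gen_g] that S(2) by blast
      ultimately show False using generic_Compl_not_generic definable_mono[OF d] by blast
    qed
    then show "\<exists>y\<in>?A. \<forall>x\<in>S. R x y" using zB by blast
    have "\<not> R z y" if "y \<in> S" for y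
    proof
      assume "R z y"
      moreover have "definable M (B \<union> S) {x. R x y}" using dfn2_fibre[OF R(1), of "B \<union> S" y] that by auto
      ultimately have "generic_set {x. R x y}" using generic_overD[OF z] by simp
      then show False using ngen_u that S(2) by blast
    qed
    then show "\<exists>x\<in>?A. \<forall>y\<in>S. \<not> R x y" using zB by blast
  qed
  then show False using no_ladder_dfn2[OF R(1)] by blast
qed

end

section \<open>Polynomials\<close>

abbreviation polys_over :: "'a::field set \<Rightarrow> 'a poly set" where
  "polys_over F \<equiv> {p. \<forall>i. coeff p i \<in> F}"

lemma subfieldD:
  assumes "is_subfield F"
  shows "0 \<in> F" "1 \<in> F" "x \<in> F \<Longrightarrow> y \<in> F \<Longrightarrow> x + y \<in> F" "x \<in> F \<Longrightarrow> y \<in> F \<Longrightarrow> x * y \<in> F"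
    "x \<in> F \<Longrightarrow> - x \<in> F" "x \<in> F \<Longrightarrow> inverse x \<in> F" "x \<in> F \<Longrightarrow> y \<in> F \<Longrightarrow> x - y \<in> F"
  using assms unfolding is_subfield_def diff_conv_add_uminus by blast+

lemma polys_over_diff: "is_subfield F \<Longrightarrow> p \<in> polys_over F \<Longrightarrow> q \<in> polys_over F \<Longrightarrow> p - q \<in> polys_over F"
  by (auto intro: subfieldD(7))

text \<open>Subtracting the monomial multiple of \<open>r\<close> with the same leading term lowers
  the degree and keeps all coefficients in \<open>F\<close>.\<close>

lemma polys_over_division:
  fixes p r :: "'a::field poly"
  assumes F: "is_subfield F" and r: "r \<in> polys_over F" "r \<noteq> 0" and p: "p \<in> polys_over F"
  obtains s t where "p = s * r + t" "t \<in> polys_over F" "t = 0 \<or> degree t < degree r"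
proof -
  have "\<exists>s t. p = s * r + t \<and> t \<in> polys_over F \<and> (t = 0 \<or> degree t < degree r)"
    using p
  proof (induction "degree p" arbitrary: p rule: less_induct)
    case less
    show ?case
    proof (cases "p = 0 \<or> degree p < degree r")
      case True
      then show ?thesis using less.prems by (intro exI[of _ 0] exI[of _ p]) auto
    next
      case False
      define m where "m = monom (lead_coeff p * inverse (lead_coeff r)) (degree p - degree r)"
      define p' where "p' = p - m * r"
      have "m * r \<in> polys_over F"
        using less.prems r(1) subfieldD[OF F] by (auto simp: m_def coeff_monom_mult)
      then have p': "p' \<in> polys_over F"
        unfolding p'_def by (rule polys_over_diff[OF F less.prems])
      have dm: "degree (m * r) = degree p"
        using False r(2) by (auto simp: m_def degree_mult_eq degree_monom_eq monom_eq_0_iff)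
      have lm: "lead_coeff (m * r) = lead_coeff p"
        unfolding lead_coeff_mult using r(2) False by (auto simp: m_def degree_monom_eq)
      have "coeff p' (degree p) = 0" using dm lm by (simp add: p'_def)
      moreover have "degree p' \<le> degree p" using dm by (simp add: p'_def degree_diff_le)
      ultimately have "p' = 0 \<or> degree p' < degree p"
        by (metis leading_coeff_0_iff le_neq_implies_less)
      then have "\<exists>s t. p' = s * r + t \<and> t \<in> polys_over F \<and> (t = 0 \<or> degree t < degree r)"
      proof
        assume "p' = 0"
        then show ?thesis using subfieldD(1)[OF F] by (intro exI[of _ 0]) auto
      qed (use less.hyps p' in blast)
      then obtain s t where st: "p' = s * r + t" "t \<in> polys_over F" "t = 0 \<or> degree t < degree r" by blast
      have "p = (m + s) * r + t" using st(1) by (simp add: p'_def algebra_simps)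
      then show ?thesis using st(2,3) by blast
    qed
  qed
  then show ?thesis using that by blast
qed

text \<open>A polynomial \<open>m\<close> over \<open>F\<close> of least degree vanishing at
  \<open>g\<close> divides \<open>q\<close>, and by the product rule a multiple root of
  \<open>m\<close> would be a multiple root of \<open>q\<close>.\<close>

lemma minimal_simple_root:
  fixes g :: "'a::field"
  assumes F: "is_subfield F" and q: "q \<in> polys_over F" "poly q g = 0" "poly (pderiv q) g \<noteq> 0"
    and r: "r \<in> polys_over F" "r \<noteq> 0" "poly r g = 0"
  shows "\<exists>m\<in>polys_over F. poly m g = 0 \<and> poly (pderiv m) g \<noteq> 0 \<and> degree m \<le> degree r"
proof -
  define Q where "Q = (\<lambda>m. m \<in> polys_over F \<and> m \<noteq> 0 \<and> poly m g = 0)"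
  obtain m where m: "Q m" "\<And>m'. Q m' \<Longrightarrow> degree m \<le> degree m'"
    using ex_has_least_nat[of Q r degree] r unfolding Q_def by blast
  have mF: "m \<in> polys_over F" "m \<noteq> 0" "poly m g = 0" using m(1) unfolding Q_def by auto
  obtain s t where st: "q = s * m + t" "t \<in> polys_over F" "t = 0 \<or> degree t < degree m"
    by (rule polys_over_division[OF F mF(1,2) q(1)])
  have "poly t g = 0" using q(2) mF(3) st(1) by simp
  then have "t = 0" using m(2)[of t] st(2,3) unfolding Q_def by fastforce
  then have "poly (pderiv m) g \<noteq> 0" using q(3) mF(3) st(1) by (auto simp: pderiv_mult)
  then show ?thesis using mF m(2)[of r] r unfolding Q_def by blast
qed

lemma ex_power_neq:
  assumes "infinite (UNIV :: 'a::field set)" "k \<noteq> j"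
  shows "\<exists>t::'a. t \<noteq> 0 \<and> t ^ k \<noteq> t ^ j"
proof -
  have "monom 1 k - monom 1 j \<noteq> (0 :: 'a poly)"
    using assms(2) by (simp add: monom_eq_iff')
  then have "finite (insert 0 {t. poly (monom 1 k - monom 1 j) t = (0::'a)})"
    using poly_roots_finite by blast
  then obtain t :: 'a where "t \<notin> insert 0 {t. poly (monom 1 k - monom 1 j) t = 0}"
    using assms(1) ex_new_if_finite by blast
  then show ?thesis by (auto simp: poly_monom)
qed

text \<open>Subtracting \<open>t\<^sup>j\<close> times a polynomial from its rescaling by \<open>t\<close> removes the monomial of degree
  \<open>j\<close>; the linear coefficient of \<open>(X + 1)\<^sup>k\<close> is \<open>k\<close>.\<close>

lemma linear_in_affine_invariant_space:
  fixes V :: "'a::field poly set"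
  assumes inf: "infinite (UNIV :: 'a set)"
    and add: "\<And>p q. p \<in> V \<Longrightarrow> q \<in> V \<Longrightarrow> p + q \<in> V"
    and smult: "\<And>c p. p \<in> V \<Longrightarrow> smult c p \<in> V"
    and scale: "\<And>t p. t \<noteq> 0 \<Longrightarrow> p \<in> V \<Longrightarrow> pcompose p [:0, t:] \<in> V"
    and shift: "\<And>u p. p \<in> V \<Longrightarrow> pcompose p [:- u, 1:] \<in> V"
    and p: "p \<in> V" "pderiv p \<noteq> 0"
  shows "[:0, 1:] \<in> V"
proof -
  have monomial: "monom 1 k \<in> V" if "p \<in> V" "coeff p k \<noteq> 0" for p k
    using that
  proof (induction "card {i. coeff p i \<noteq> 0}" arbitrary: p rule: less_induct)
    case less
    have fin: "finite {i. coeff p i \<noteq> 0}"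
      using MOST_coeff_eq_0[of p] by (simp add: eventually_cofinite)
    show ?case
    proof (cases "\<exists>j. j \<noteq> k \<and> coeff p j \<noteq> 0")
      case True
      then obtain j where j: "j \<noteq> k" "coeff p j \<noteq> 0" by blast
      obtain t :: 'a where t: "t \<noteq> 0" "t ^ k \<noteq> t ^ j" using ex_power_neq[OF inf] j(1) by metis
      define q where "q = pcompose p [:0, t:] + smult (- (t ^ j)) p"
      have q: "coeff q i = (t ^ i - t ^ j) * coeff p i" for i
        by (simp add: q_def coeff_pcompose_linear algebra_simps)
      have "{i. coeff q i \<noteq> 0} \<subset> {i. coeff p i \<noteq> 0}" using j(2) by (auto simp: q)
      then have "card {i. coeff q i \<noteq> 0} < card {i. coeff p i \<noteq> 0}" by (rule psubset_card_mono[OF fin])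
      moreover have "q \<in> V" unfolding q_def by (intro add smult scale t(1) less.prems)
      moreover have "coeff q k \<noteq> 0" using t(2) less.prems(2) by (simp add: q)
      ultimately show ?thesis by (rule less.hyps)
    next
      case False
      then have "smult (inverse (coeff p k)) p = monom 1 k"
        using less.prems(2) by (auto simp: poly_eq_iff)
      then show ?thesis using smult[OF less.prems(1)] by metis
    qed
  qed
  \<comment> \<open>The derivative supplies an exponent \<open>Suc k\<close> that occurs in
    \<open>p\<close> and is nonzero as an element of the field, so \<open>[:1, 1:] ^ Suc k\<close>
    has a linear term.\<close>
  obtain k where k: "coeff (pderiv p) k \<noteq> 0" using p(2) by (auto simp: poly_eq_iff)
  then have "coeff p (Suc k) \<noteq> 0" and k': "(of_nat (Suc k) :: 'a) \<noteq> 0"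
    unfolding coeff_pderiv by auto
  then have "monom 1 (Suc k) \<in> V" using monomial[OF p(1)] by blast
  moreover have "pcompose (monom 1 n) [:1, 1:] = ([:1, 1:] ^ n :: 'a poly)" for n :: nat
    by (induction n) (simp_all add: monom_Suc monom_0 pcompose_pCons)
  ultimately have "[:1, 1:] ^ Suc k \<in> V" using shift[of "monom 1 (Suc k)" "- 1"]
    by (simp del: power_Suc)
  moreover have "coeff ([:1, 1:] ^ Suc k :: 'a poly) 1 = of_nat (Suc k)"
    by (subst coeff_linear_poly_power) auto
  ultimately have "monom (1 :: 'a) 1 \<in> V" using monomial k' by metis
  then show ?thesis by (simp add: monom_Suc monom_0)
qed

section \<open>Definability of polynomial values and roots\<close>

lemma ex_tm_poly:
  assumes "\<forall>i. coeff q i \<in> B"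
  shows "\<exists>t. tm_params t \<subseteq> B \<and> tm_vars t \<subseteq> {0} \<and> (\<forall>e. tm_val e t = poly q (e 0))"
  using assms
proof (induction q)
  case 0
  then show ?case by (intro exI[of _ Zero]) auto
next
  case (pCons a q)
  have "\<forall>i. coeff q i \<in> B" using pCons.prems by (metis coeff_pCons_Suc)
  then obtain t where "tm_params t \<subseteq> B" "tm_vars t \<subseteq> {0}" "\<forall>e. tm_val e t = poly q (e 0)"
    using pCons.IH by blast
  moreover have "a \<in> B" using pCons.prems by (metis coeff_pCons_0)
  ultimately show ?case by (intro exI[of _ "Add (Cst a) (Mul (Var 0) t)"]) auto
qed

lemma definable_poly:
  assumes "definable M B X" "\<forall>i. coeff q i \<in> B"
  shows "definable M B {x. poly q x \<in> X}"
  using ex_tm_poly[OF assms(2)] definable_preimage[OF assms(1)] by fastforce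

text \<open>Coefficients range over definable sets because the polynomials of interest have
  coefficients nongeneric over \<open>B\<close> rather than in \<open>B\<close>.\<close>

lemma dfn_poly_value:
  fixes M :: "('r, 'a::field) struct"
  assumes "\<And>i. i < n \<Longrightarrow> definable M B (X i)"
  shows "dfn2 M B (\<lambda>x y. \<exists>c. (\<forall>i<n. c i \<in> X i) \<and> y = (\<Sum>i<n. c i * x ^ i))"
  using assms
proof (induction n)
  case 0
  then show ?case using dfn_eq[of "Var 1" B Zero] unfolding dfn2_def by simp
next
  case (Suc n)
  let ?V = "\<lambda>x y. \<exists>c. (\<forall>i<n. c i \<in> X i) \<and> y = (\<Sum>i<n. c i * x ^ i)"
  define t :: "'a tm" where "t = ((Mul (Var 0)) ^^ n) One"
  have pow: "tm_val e ((Mul (Var 0) ^^ m) One) = e 0 ^ m" "tm_params ((Mul (Var 0) ^^ m) One) = ({} :: 'a set)"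
    for e :: "nat \<Rightarrow> 'a" and m by (induction m) auto
  \<comment> \<open>Variable \<open>3\<close> holds the value of the terms below degree
    \<open>n\<close> and variable \<open>2\<close> the coefficient of degree \<open>n\<close>; both
    are then quantified.\<close>
  have V: "dfn M B (\<lambda>e. ?V (e 0) (e 3))"
    using dfn_rename[of M B "\<lambda>e. ?V (e 0) (e 1)" 1 3] Suc unfolding dfn2_def by simp
  have X: "dfn M B (\<lambda>e. e 2 \<in> X n)"
    using dfn_rename[of M B "\<lambda>e. e 0 \<in> X n" 0 2] Suc.prems unfolding definable_def by simp
  have "dfn M B (\<lambda>e. tm_val e (Var 1) = tm_val e (Add (Var 3) (Mul (Var 2) t)))"
    by (rule dfn_eq) (auto simp: t_def pow)
  then have E: "dfn M B (\<lambda>e. e 1 = e 3 + e 2 * e 0 ^ n)" by (simp add: t_def pow)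
  from dfn_ex[OF dfn_ex[OF dfn_conj[OF X dfn_conj[OF E V]], of 3], of 2]
  have "dfn M B (\<lambda>e. \<exists>a b. a \<in> X n \<and> e 1 = b + a * e 0 ^ n \<and> ?V (e 0) b)" by simp
  then show ?case unfolding dfn2_def
  proof (rule dfn_cong)
    fix e :: "nat \<Rightarrow> 'a"
    show "(\<exists>a b. a \<in> X n \<and> e 1 = b + a * e 0 ^ n \<and> ?V (e 0) b) =
       (\<exists>c. (\<forall>i<Suc n. c i \<in> X i) \<and> e 1 = (\<Sum>i<Suc n. c i * e 0 ^ i))" (is "?L = ?R")
    proof
      assume ?L
      then obtain a c where ac: "a \<in> X n" "\<forall>i<n. c i \<in> X i" "e 1 = (\<Sum>i<n. c i * e 0 ^ i) + a * e 0 ^ n"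
        by blast
      have "(\<Sum>i<n. (c(n := a)) i * e 0 ^ i) = (\<Sum>i<n. c i * e 0 ^ i)" by (rule sum.cong) auto
      then show ?R using ac by (intro exI[of _ "c(n := a)"]) (auto simp: less_Suc_eq)
    next
      assume ?R
      then obtain c where "\<forall>i<Suc n. c i \<in> X i" "e 1 = (\<Sum>i<Suc n. c i * e 0 ^ i)" by blast
      then have "c n \<in> X n" "e 1 = (\<Sum>i<n. c i * e 0 ^ i) + c n * e 0 ^ n" "\<forall>i<n. c i \<in> X i"
        by auto
      then show ?L by blast
    qed
  qed
qed

text \<open>Being such a root is definable over \<open>B\<close>, so it passes from one generic over
  \<open>B\<close> to another. If the sets \<open>X i\<close> are nongeneric, the new coefficients
  \<open>c i\<close> are nongeneric as well.\<close>

lemma definable_monic_root: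
  fixes M :: "('r, 'a::field) struct"
  assumes "\<And>i. i < n \<Longrightarrow> definable M B (X i)"
  shows "definable M B {x. \<exists>c. (\<forall>i<n. c i \<in> X i) \<and> x ^ n + (\<Sum>i<n. c i * x ^ i) = 0}"
proof -
  let ?V = "\<lambda>x y. \<exists>c. (\<forall>i<n. c i \<in> X i) \<and> y = (\<Sum>i<n. c i * x ^ i)"
  define t :: "'a tm" where "t = Neg (((Mul (Var 0)) ^^ n) One)"
  have "tm_val e ((Mul (Var 0) ^^ m) One) = e 0 ^ m" "tm_params ((Mul (Var 0) ^^ m) One) = ({} :: 'a set)"
    for e :: "nat \<Rightarrow> 'a" and m by (induction m) auto
  then have t: "tm_val e t = - (e 0 ^ n)" "tm_params t \<subseteq> B" for e by (auto simp: t_def)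
  have "dfn M B (\<lambda>e. ?V (e 0) (- (e 0 ^ n)))"
    using dfn_subst[OF dfn_poly_value[of n M B X, OF assms, unfolded dfn2_def] t(2), of 1] t(1) by simp
  then show ?thesis unfolding definable_def by (rule dfn_cong) (auto simp: neg_eq_iff_add_eq_0)
qed

lemma monic_poly_coeffs:
  fixes c :: "nat \<Rightarrow> 'a::field" and n :: nat
  defines "p \<equiv> monom 1 n + (\<Sum>i<n. monom (c i) i)"
  shows "coeff p j = (if j = n then 1 else if j < n then c j else 0)"
    and "poly p x = x ^ n + (\<Sum>i<n. c i * x ^ i)" and "degree p = n"
proof -
  show *: "coeff p j = (if j = n then 1 else if j < n then c j else 0)" for j
    by (auto simp: p_def coeff_sum)
  show "poly p x = x ^ n + (\<Sum>i<n. c i * x ^ i)"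
    by (simp add: p_def poly_monom poly_sum)
  show "degree p = n"
    by (rule antisym[OF degree_le le_degree]) (auto simp: *)
qed

section \<open>Fields in which the nongeneric elements are closed under addition and multiplication\<close>

locale nongeneric_closed_field = monster_field M \<kappa>
  for M :: "('r, 'a::field) struct" and \<kappa> :: "'c rel" +
  assumes nongeneric_closed: "\<And>B x y. small \<kappa> B \<Longrightarrow> x \<in> nongeneric M B \<Longrightarrow> y \<in> nongeneric M B \<Longrightarrow>
    x + y \<in> nongeneric M B \<and> x * y \<in> nongeneric M B"
begin

lemma definable_singleton_nongeneric: "definable M B {x} \<Longrightarrow> x \<in> nongeneric M B"
  unfolding nongeneric_iff using not_generic_finite[of "{x}"] by blast

lemma params_nongeneric: "B \<subseteq> nongeneric M B"
  using definable_singleton_nongeneric definable_singleton by blast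

text \<open>The points \<open>0\<close>, \<open>1\<close> and \<open>-1\<close> are definable, hence
  nongeneric. Negatives are products with \<open>-1\<close>, and inverses come from
  \<open>generic_inverse\<close>.\<close>

lemma nongeneric_subfield:
  assumes B: "small \<kappa> B"
  shows "is_subfield (nongeneric M B)"
  unfolding is_subfield_def
proof (intro conjI ballI)
  show "0 \<in> nongeneric M B" "1 \<in> nongeneric M B"
    using definable_singleton_nongeneric definable_zero definable_one by blast+
  fix x assume x: "x \<in> nongeneric M B"
  have "-1 \<in> nongeneric M B" using definable_singleton_nongeneric definable_minus_one by blast
  then show "- x \<in> nongeneric M B" using nongeneric_closed[OF B x, of "-1"] by simp
  show "inverse x \<in> nongeneric M B"
  proof (cases "x = 0")
    case True
    then show ?thesis using x by simp
  next
    case False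
    obtain X where X: "definable M B X" "x \<in> X" "\<not> generic_set X"
      using x unfolding nongeneric_iff by blast
    have "\<not> generic_set {y. y \<noteq> 0 \<and> inverse y \<in> X}"
      using generic_inverse[OF definable_mono[OF X(1) subset_UNIV]] X(3) by blast
    then show ?thesis
      unfolding nongeneric_iff using definable_inverse[OF X(1)] X(2) False
      by (intro exI[of _ "{y. y \<noteq> 0 \<and> inverse y \<in> X}"]) auto
  qed
  show "x + y \<in> nongeneric M B" "x * y \<in> nongeneric M B" if "y \<in> nongeneric M B" for y
    using nongeneric_closed[OF B x that] by auto
qed

text \<open>The base may depend on \<open>p\<close>, so it can absorb any scalar; this makes the set
  a vector space over the whole field, closed under affine substitutions.\<close>

definition good :: "'a poly set" where
  "good = {p. \<exists>B. small \<kappa> B \<and> (\<forall>w. generic_over M B w \<longrightarrow> poly p w \<in> nongeneric M B)}"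

lemma goodE:
  assumes "p \<in> good"
  obtains B where "small \<kappa> B"
    "\<forall>C w. B \<subseteq> C \<longrightarrow> generic_over M B w \<longrightarrow> poly p w \<in> nongeneric M C"
proof -
  obtain B where "small \<kappa> B" "\<forall>w. generic_over M B w \<longrightarrow> poly p w \<in> nongeneric M B"
    using assms unfolding good_def by blast
  then show ?thesis by (intro that[of B]) (use nongeneric_mono in blast)+
qed

lemma goodI: "small \<kappa> B \<Longrightarrow> (\<And>w. generic_over M B w \<Longrightarrow> poly p w \<in> nongeneric M B) \<Longrightarrow> p \<in> good"
  unfolding good_def by blast

text \<open>Otherwise \<open>[:0, 1:]\<close> would be good, and a generic over its base would be
  nongeneric over the same base.\<close>

lemma good_pderiv_eq_0:
  assumes "p \<in> good"
  shows "pderiv p = 0"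
proof (rule ccontr)
  assume "pderiv p \<noteq> 0"
  \<comment> \<open>The placeholders stand for the closure properties under sums, scalars, rescaling
    and shifts, which the four blocks below prove.\<close>
  with infinite_UNIV _ _ _ _ assms have "[:0, 1:] \<in> good"
  proof (rule linear_in_affine_invariant_space)
    fix p q assume "p \<in> good" "q \<in> good"
    from this(1) obtain B where B: "small \<kappa> B"
      "\<forall>C w. B \<subseteq> C \<longrightarrow> generic_over M B w \<longrightarrow> poly p w \<in> nongeneric M C" by (rule goodE)
    from \<open>q \<in> good\<close> obtain B' where B': "small \<kappa> B'"
      "\<forall>C w. B' \<subseteq> C \<longrightarrow> generic_over M B' w \<longrightarrow> poly q w \<in> nongeneric M C" by (rule goodE)
    have sm: "small \<kappa> (B \<union> B')" using small_Un B(1) B'(1) .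
    show "p + q \<in> good"
    proof (rule goodI[OF sm])
      fix w assume "generic_over M (B \<union> B') w"
      then have "generic_over M B w" "generic_over M B' w" using generic_over_anti by blast+
      then show "poly (p + q) w \<in> nongeneric M (B \<union> B')"
        using nongeneric_closed[OF sm] B(2) B'(2) by simp
    qed
  next
    fix c p assume "p \<in> good"
    then obtain B where B: "small \<kappa> B"
      "\<forall>C w. B \<subseteq> C \<longrightarrow> generic_over M B w \<longrightarrow> poly p w \<in> nongeneric M C" by (rule goodE)
    note sm = small_insert[OF B(1), of c]
    show "smult c p \<in> good"
    proof (rule goodI[OF sm])
      fix w assume "generic_over M (insert c B) w"
      then have "generic_over M B w" using generic_over_anti by blast
      then show "poly (smult c p) w \<in> nongeneric M (insert c B)"
        using nongeneric_closed[OF sm] B(2)[rule_format, of "insert c B"] params_nongeneric[of "insert c B"] by auto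
    qed
  next
    fix t :: 'a and p assume t: "t \<noteq> 0" "p \<in> good"
    from t(2) obtain B where B: "small \<kappa> B"
      "\<forall>C w. B \<subseteq> C \<longrightarrow> generic_over M B w \<longrightarrow> poly p w \<in> nongeneric M C" by (rule goodE)
    show "pcompose p [:0, t:] \<in> good"
    proof (rule goodI[OF small_insert[OF B(1)]])
      fix w assume "generic_over M (insert t B) w"
      then have "generic_over M (insert t B) (t * w)" by (rule generic_over_mult) (use t in auto)
      then have "generic_over M B (t * w)" using generic_over_anti by blast
      then show "poly (pcompose p [:0, t:]) w \<in> nongeneric M (insert t B)"
        using B(2)[rule_format, of "insert t B" "t * w"] by (auto simp: poly_pcompose mult.commute)
    qed
  next
    fix u p assume "p \<in> good"
    then obtain B where B: "small \<kappa> B"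
      "\<forall>C w. B \<subseteq> C \<longrightarrow> generic_over M B w \<longrightarrow> poly p w \<in> nongeneric M C" by (rule goodE)
    show "pcompose p [:- u, 1:] \<in> good"
    proof (rule goodI[OF small_insert[OF B(1)]])
      fix w assume "generic_over M (insert u B) w"
      then have "generic_over M (insert u B) (w - u)" by (rule generic_over_diff) simp
      then have "generic_over M B (w - u)" using generic_over_anti by blast
      then show "poly (pcompose p [:- u, 1:]) w \<in> nongeneric M (insert u B)"
        using B(2)[rule_format, of "insert u B" "w - u"] by (auto simp: poly_pcompose)
    qed
  qed
  then obtain B where B: "small \<kappa> B"
    "\<forall>C w. B \<subseteq> C \<longrightarrow> generic_over M B w \<longrightarrow> poly [:0, 1:] w \<in> nongeneric M C" by (rule goodE)
  obtain w where w: "generic_over M B w" using ex_generic_over[OF B(1)] ..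
  then show False using B(2)[rule_format, OF subset_refl w] by (simp add: nongeneric_def)
qed

definition simple_root :: "'a set \<Rightarrow> 'a \<Rightarrow> 'a poly \<Rightarrow> bool" where
  "simple_root B g q \<longleftrightarrow> small \<kappa> B \<and> generic_over M B g \<and> q \<in> polys_over (nongeneric M B)
     \<and> poly q g = 0 \<and> poly (pderiv q) g \<noteq> 0"

text \<open>Take such a \<open>q\<close> of least degree among all bases \<open>B\<close>. For \<open>w\<close> generic over everything,
  \<open>g - w\<close> has the same type over \<open>B\<close> as \<open>g\<close>, so it is a root of a monic \<open>q\<^sub>1\<close> of the same degree,
  and minimality over \<open>B \<union> {w}\<close> forces \<open>q = q\<^sub>1(X - w)\<close>. Hence \<open>q(w) = q\<^sub>1(0)\<close> is nongeneric.\<close>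

lemma no_simple_root: "\<not> simple_root B g q"
proof
  assume "simple_root B g q"
  define Q where "Q = (\<lambda>(B, g, q). simple_root B g q)"
  obtain x where x: "Q x" "\<And>y. Q y \<Longrightarrow> degree (snd (snd x)) \<le> degree (snd (snd y))"
    using ex_has_least_nat[of Q "(B, g, q)" "\<lambda>x. degree (snd (snd x))"] \<open>simple_root B g q\<close>
    unfolding Q_def by auto
  obtain B g q0 where "x = (B, g, q0)" by (metis prod_cases3)
  then have q0: "simple_root B g q0"
    and least: "\<And>B' g' q'. simple_root B' g' q' \<Longrightarrow> degree q0 \<le> degree q'"
    using x unfolding Q_def by auto
  have B: "small \<kappa> B" and g: "generic_over M B g" using q0 unfolding simple_root_def by auto
  note F = nongeneric_subfield
  define n where "n = degree q0"
  define q where "q = smult (inverse (lead_coeff q0)) q0"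
  have "q0 \<noteq> 0" using q0 unfolding simple_root_def by auto
  then have qn: "degree q = n" "lead_coeff q = 1" by (auto simp: q_def n_def)
  have qF: "q \<in> polys_over (nongeneric M B)"
    using q0 subfieldD(4,6)[OF F[OF B]] unfolding simple_root_def q_def by auto
  have qg: "poly q g = 0" "poly (pderiv q) g \<noteq> 0"
    using q0 \<open>q0 \<noteq> 0\<close> unfolding simple_root_def q_def by (auto simp: pderiv_smult)
  \<comment> \<open>Adding the coefficients of \<open>q\<close> to the base makes preimages under
    \<open>q\<close> definable, as the final transfer from \<open>w\<close> to other generics
    requires.\<close>
  define C where "C = range (coeff q)"
  have C: "finite C" by (simp add: C_def range_coeff)
  have sm: "small \<kappa> (insert g B \<union> C)" by (intro small_Un small_insert B small_finite[OF C])
  obtain w where w: "generic_over M (insert g B \<union> C) w" using ex_generic_over[OF sm] ..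
  let ?Bw = "insert w B"
  have gw: "generic_over M ?Bw g"
    by (rule generic_over_sym[OF B g generic_over_anti[OF w]]) auto
  have Bw: "small \<kappa> ?Bw" using small_insert[OF B] .
  have NBw: "nongeneric M B \<subseteq> nongeneric M ?Bw" by (rule nongeneric_mono) auto
  have gmw: "generic_over M B (g - w)"
    by (rule generic_over_anti[OF generic_over_diff[OF gw]]) auto
  \<comment> \<open>Each coefficient is confined to a nongeneric set definable over
    \<open>B\<close>; having a root with such coefficients is what \<open>g - w\<close> inherits
    from \<open>g\<close>.\<close>
  have "\<exists>X. definable M B X \<and> coeff q i \<in> X \<and> \<not> generic_set X" for i
    using qF unfolding nongeneric_iff by blast
  then have "\<exists>X. \<forall>i. definable M B (X i) \<and> coeff q i \<in> X i \<and> \<not> generic_set (X i)"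
    by (intro choice allI)
  then obtain X where "\<forall>i. definable M B (X i) \<and> coeff q i \<in> X i \<and> \<not> generic_set (X i)" ..
  then have X: "definable M B (X i)" "coeff q i \<in> X i" "\<not> generic_set (X i)" for i by blast+
  have "g ^ n + (\<Sum>i<n. coeff q i * g ^ i) = poly q g"
    using qn unfolding poly_altdef by (simp flip: lessThan_Suc_atMost)
  then have "g \<in> {x. \<exists>c. (\<forall>i<n. c i \<in> X i) \<and> x ^ n + (\<Sum>i<n. c i * x ^ i) = 0}"
    using X(2) qg(1) by auto
  then have "g - w \<in> {x. \<exists>c. (\<forall>i<n. c i \<in> X i) \<and> x ^ n + (\<Sum>i<n. c i * x ^ i) = 0}"
    by (rule generic_over_same[OF g gmw definable_monic_root[OF X(1)]])
  then obtain c where c: "\<forall>i<n. c i \<in> X i" "(g - w) ^ n + (\<Sum>i<n. c i * (g - w) ^ i) = 0" by blast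
  define q1 where "q1 = monom 1 n + (\<Sum>i<n. monom (c i) i)"
  note q1 = monic_poly_coeffs[of n c, folded q1_def]
  have cF: "c i \<in> nongeneric M B" if "i < n" for i
    using c(1) X(1,3) that unfolding nongeneric_iff by blast
  have q1F: "coeff q1 i \<in> nongeneric M B" for i
    using cF subfieldD(1,2)[OF F[OF B]] by (simp add: q1(1))
  \<comment> \<open>Both polynomials are monic of degree \<open>n\<close> and vanish at
    \<open>g\<close>, so a nonzero \<open>r\<close> would have smaller degree and
    \<open>minimal_simple_root\<close> would contradict the choice of \<open>q0\<close>, as
    \<open>g\<close> remains generic over \<open>?Bw\<close>.\<close>
  define r where "r = pcompose q1 [:- w, 1:] - q"
  note Fw = subfieldD[OF F[OF Bw]]
  have wF: "coeff [:- w, 1:] i \<in> nongeneric M ?Bw" for i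
    using params_nongeneric[of ?Bw] Fw by (auto simp: coeff_pCons split: nat.splits)
  have "coeff (pcompose q1 [:- w, 1:]) i \<in> nongeneric M ?Bw" for i
    by (rule coeff_pcompose_semiring_closed) (use Fw wF q1F NBw in auto)
  then have rF: "r \<in> polys_over (nongeneric M ?Bw)"
    unfolding r_def by (intro polys_over_diff[OF F[OF Bw]]) (use qF NBw in auto)
  have rg: "poly r g = 0" using c(2) qg(1) by (simp add: r_def poly_pcompose q1(2))
  have dr: "degree (pcompose q1 [:- w, 1:]) = n" by (simp add: degree_pcompose q1(3))
  have "lead_coeff (pcompose q1 [:- w, 1:]) = 1" by (subst lead_coeff_comp) (simp_all add: q1)
  then have "coeff r n = 0" using qn dr by (simp add: r_def)
  moreover have "degree r \<le> n" unfolding r_def using dr qn by (simp add: degree_diff_le)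
  ultimately have "r = 0 \<or> degree r < n" by (metis leading_coeff_0_iff le_neq_implies_less)
  moreover have "\<not> degree r < n" if r0: "r \<noteq> 0"
  proof -
    have "q \<in> polys_over (nongeneric M ?Bw)" using qF NBw by auto
    then obtain m where "m \<in> polys_over (nongeneric M ?Bw)" "poly m g = 0" "poly (pderiv m) g \<noteq> 0"
      "degree m \<le> degree r"
      using minimal_simple_root[OF F[OF Bw] _ qg rF r0 rg] by blast
    then show ?thesis using least[of ?Bw g m] gw Bw unfolding simple_root_def n_def by auto
  qed
  ultimately have "r = 0" by blast
  then have "q = pcompose q1 [:- w, 1:]" by (simp add: r_def)
  then have "poly q w = coeff q1 0" by (simp add: poly_pcompose poly_0_coeff_0)
  then have qw: "poly q w \<in> nongeneric M (B \<union> C)"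
    using q1F nongeneric_mono[of B "B \<union> C" M] by auto
  then obtain Y where Y: "definable M (B \<union> C) Y" "poly q w \<in> Y" "\<not> generic_set Y"
    unfolding nongeneric_iff by blast
  have wBC: "generic_over M (B \<union> C) w" by (rule generic_over_anti[OF w]) auto
  have dY: "definable M (B \<union> C) {x. poly q x \<in> Y}"
    by (rule definable_poly[OF Y(1)]) (auto simp: C_def)
  \<comment> \<open>Membership of the value in the nongeneric \<open>Y\<close> is definable over
    \<open>B \<union> C\<close>, so it passes from \<open>w\<close> to all generics over that
    set.\<close>
  have "q \<in> good"
  proof (rule goodI[OF small_Un[OF B small_finite[OF C]]])
    fix v assume "generic_over M (B \<union> C) v"
    then have "v \<in> {x. poly q x \<in> Y}" by (rule generic_over_same[OF wBC _ dY]) (use Y in auto)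
    then show "poly q v \<in> nongeneric M (B \<union> C)" using Y unfolding nongeneric_iff by blast
  qed
  then show False using good_pderiv_eq_0 qg(2) by auto
qed

end

text \<open>If \<open>h\<close> were nongeneric over \<open>A\<close>, the subfield
  \<open>nongeneric M A\<close> would contain \<open>A \<union> {h}\<close> and hence the generated
  field, so \<open>g\<close> would be a simple root of a polynomial over it.\<close>

theorem corollary2p4:
  fixes M :: "('r, 'a::field) struct" and \<kappa> :: "'c rel"
    and A :: "'a set" and g h :: 'a
  assumes "infinite (UNIV :: 'a set)"
    and "stable_struct M"
    and "monster_model \<kappa> M"
    and nongeneric_closed:
      "\<And>B x y. small \<kappa> B \<Longrightarrow> \<not> generic_over M B x \<Longrightarrow> \<not> generic_over M B y \<Longrightarrow>
         \<not> generic_over M B (x + y) \<and> \<not> generic_over M B (x * y)"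
    and "small \<kappa> A"
    and "generic_over M A g"
    and "separably_algebraic (is_subfield hull (A \<union> {h})) g"
  shows "generic_over M A h"
proof (rule ccontr)
  assume h: "\<not> generic_over M A h"
  interpret nongeneric_closed_field M \<kappa>
    by unfold_locales (use assms in \<open>auto simp: nongeneric_def\<close>)
  have "A \<union> {h} \<subseteq> nongeneric M A" using params_nongeneric h by (auto simp: nongeneric_def)
  then have hull: "is_subfield hull (A \<union> {h}) \<subseteq> nongeneric M A"
    by (rule hull_minimal) (rule nongeneric_subfield[OF assms(5)])
  obtain q where q: "\<forall>i. coeff q i \<in> is_subfield hull (A \<union> {h})" "coprime q (pderiv q)" "poly q g = 0"
    using assms(7) unfolding separably_algebraic_def separable_poly_def by blast
  \<comment> \<open>A common root of \<open>q\<close> and its derivative would make the nonunit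
    \<open>[:- g, 1:]\<close> a common divisor.\<close>
  have "poly (pderiv q) g \<noteq> 0"
  proof
    assume "poly (pderiv q) g = 0"
    then have "is_unit [:- g, 1:]"
      using coprime_common_divisor[OF q(2)] q(3) by (simp add: poly_eq_0_iff_dvd)
    then show False by (simp add: is_unit_iff_degree)
  qed
  then have "simple_root A g q"
    using q hull assms(5,6) unfolding simple_root_def by auto
  then show False using no_simple_root by blast
qed

end
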